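(* Let $\lambda>0$ and let $\{c_k\}_{k\ge1}$ be i.i.d. random variables whose common distribution is absolutely continuous on $[0,1]$ with a density that is uniformly bounded and positive almost everywhere on $[0,1]$. Let $l_k=e^{-\lambda k}$, let $I_k$ be the open interval of length $l_k$ centered at $c_k$, and let $S=\bigcap_{m\ge1}\bigcup_{k\ge m} I_k$. Then, almost surely, $\mathrm{Cap}(S)=\mathrm{Cap}([0,1])>0$.
   Context: For finite Borel measures $\mu,\nu$ on $\mathbb{C}$, the interaction is $I(\nu,\mu)=\iint(-\log|z-w|)\,d\nu(z)\,d\mu(w)$ and the energy is $I(\mu)=I(\mu,\mu)$. The logarithmic capacity of $E\subset\mathbb{C}$ is $\mathrm{Cap}(E)=\exp(-\inf I(\mu))$, the infimum over Borel probability measures $\mu$ whose support is a compact subset of $E$ (with $e^{-\infty}=0$). One has $\mathrm{Cap}([0,1])=1/4$. *)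

theory Defs
  imports "HOL-Probability.Probability"
begin

definition log_kernel_pos :: "complex \<Rightarrow> complex \<Rightarrow> ennreal" where
  "log_kernel_pos z w = (if z = w then \<infinity> else ennreal (max 0 (- ln (cmod (z - w)))))"

definition log_kernel_neg :: "complex \<Rightarrow> complex \<Rightarrow> ennreal" where
  "log_kernel_neg z w = (if z = w then 0 else ennreal (max 0 (ln (cmod (z - w)))))"

definition log_interaction :: "complex measure \<Rightarrow> complex measure \<Rightarrow> ereal" where
  "log_interaction \<nu> \<mu> =
     enn2ereal (\<integral>\<^sup>+ p. log_kernel_pos (fst p) (snd p) \<partial>(\<nu> \<Otimes>\<^sub>M \<mu>))
   - enn2ereal (\<integral>\<^sup>+ p. log_kernel_neg (fst p) (snd p) \<partial>(\<nu> \<Otimes>\<^sub>M \<mu>))"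

definition log_energy :: "complex measure \<Rightarrow> ereal" where
  "log_energy \<mu> = log_interaction \<mu> \<mu>"

definition msupport :: "complex measure \<Rightarrow> complex set" where
  "msupport \<mu> = {z. \<forall>e>0. emeasure \<mu> (ball z e) > 0}"

definition cap_measures :: "complex set \<Rightarrow> complex measure set" where
  "cap_measures E = {\<mu>. sets \<mu> = sets borel \<and> prob_space \<mu> \<and>
                        compact (msupport \<mu>) \<and> msupport \<mu> \<subseteq> E}"

text \<open>Logarithmic capacity Cap(E) = exp(- inf I(mu)), with exp(-infinity) = 0
  (and exp(+infinity) = infinity, which cannot occur for bounded E).\<close>

definition log_capacity :: "complex set \<Rightarrow> ereal" where
  "log_capacity E =
     (let m = (INF \<mu>\<in>cap_measures E. log_energy \<mu>) in
      if m = \<infinity> then 0 else if m = - \<infinity> then \<infinity> else ereal (exp (- real_of_ereal m)))"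

end

theory Submission
  imports Defs "HOL-Real_Asymp.Real_Asymp"
begin

text \<open>
  Only \<open>Cap S \<ge> Cap [0,1]\<close> needs an argument: a probability measure on \<open>[0,1]\<close> of energy
  below \<open>e\<close> has to be moved onto \<open>S\<close> without pushing its energy above \<open>e\<close>. First smooth it to a
  Lipschitz density. Given a Lipschitz density \<open>h\<close> of energy below \<open>e\<close>, take the random density
  \<open>\<Sum>k\<in>A. (1/k) g(c\<^sub>k) \<phi>\<^sub>k\<close>, where \<open>\<phi>\<^sub>k\<close> is a tent inside \<open>I\<^sub>k\<close> and \<open>g\<close> is a truncated version of
  \<open>h / f\<close>. The interactions of distinct tents contribute on average at most the energy of \<open>h\<close>, and
  the self-energy \<open>O(k)\<close> of \<open>\<phi>\<^sub>k\<close> is damped by the weight \<open>1/k\<^sup>2\<close>: in total it is of order \<open>H =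
  \<Sum>k\<in>A. 1/k\<close>, negligible against the squared mass \<open>H\<^sup>2\<close> since the harmonic series diverges. So on every long
  block \<open>A\<close> the energy is below \<open>e\<close> with probability bounded from below, and by independence of
  disjoint blocks this happens almost surely for some block. Iterating gives densities with
  nested compact supports inside \<open>\<Union>k\<ge>n. I\<^sub>k\<close>; a weak limit lives on \<open>S\<close> and has energy at most \<open>e\<close>
  by lower semicontinuity.
\<close>

section \<open>The logarithmic kernel and tent functions\<close>

text \<open>Inside \<open>[0,1]\<close> distances are at most 1, so the negative part of the kernel
  vanishes: energies become integrals of the nonnegative \<open>real_kernel\<close>, and Tonelli and
  Fatou apply freely. The Lipschitz condition controls \<open>h\<close> at the scale of a tent:
  \<open>h\<close> changes by at most \<open>L * rad k\<close> across the \<open>k\<close>-th one.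
  Hence for \<open>g\<close> near \<open>max 0 (h - L * r) / f\<close>, with \<open>r\<close> at
  least the radii in use, the mean of one weighted tent stays pointwise below \<open>h\<close>,
  while the mean mass loses little. Pointwise domination of means is exactly what bounds the mean
  interaction of two independent tents by the energy of \<open>h\<close>. Comparing means yields
  only a probability bounded from below, not close to 1; this is why infinitely many disjoint blocks
  are tried. The level \<open>e\<close> stays the same in every round: a refinement spends part of
  the gap below \<open>e\<close> but again ends strictly below it, so no errors accumulate. Each new
  closed support lies in the set where the previous density is nonzero, so that the nesting survives
  the weak limit.\<close>

definition real_kernel :: "real \<times> real \<Rightarrow> ennreal" where
  "real_kernel p = log_kernel_pos (complex_of_real (fst p)) (complex_of_real (snd p))"

lemma real_kernel_alt: "real_kernel p = (if fst p = snd p then \<infinity> else ennreal (max 0 (- ln \<bar>fst p - snd p\<bar>)))"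
  unfolding real_kernel_def log_kernel_pos_def by (simp flip: of_real_diff)

lemma real_kernel_measurable [measurable]: "real_kernel \<in> borel_measurable (borel \<Otimes>\<^sub>M borel)"
proof -
  have "real_kernel = (\<lambda>p. if fst p = snd p then \<infinity> else ennreal (max 0 (- ln \<bar>fst p - snd p\<bar>)))"
    by (rule ext) (rule real_kernel_alt)
  then show ?thesis by (elim ssubst) measurable
qed

definition dens_energy :: "(real \<Rightarrow> real) \<Rightarrow> ennreal" where
  "dens_energy h = (\<integral>\<^sup>+p. ennreal (h (fst p)) * ennreal (h (snd p)) * real_kernel p \<partial>(lborel \<Otimes>\<^sub>M lborel))"

text \<open>The normalised bump is a hat and not an indicator, so that finite combinations are
  Lipschitz and can be refined again.\<close>

definition tent :: "real \<Rightarrow> real \<Rightarrow> real \<Rightarrow> real" where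
  "tent r c x = max 0 (1 - \<bar>x - c\<bar> / r) / r"

lemma tent_measurable [measurable (raw)]:
  assumes [measurable]: "f \<in> borel_measurable M" "g \<in> borel_measurable M"
  shows "(\<lambda>w. tent r (f w) (g w)) \<in> borel_measurable M"
  unfolding tent_def by measurable

lemma tent_nonneg: "r > 0 \<Longrightarrow> tent r c x \<ge> 0"
  by (simp add: tent_def)

text \<open>Exchanging centre and argument turns an average over centres into the integral of a
  single tent.\<close>

lemma tent_sym: "tent r c x = tent r x c"
  by (simp add: tent_def abs_minus_commute)

lemma tent_eq_0: "r > 0 \<Longrightarrow> \<bar>x - c\<bar> \<ge> r \<Longrightarrow> tent r c x = 0"
  by (simp add: tent_def)

lemma tent_le: "r > 0 \<Longrightarrow> tent r c x \<le> 1 / r"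
  by (auto simp: tent_def divide_simps)

lemma max_lipschitz: "\<bar>max a b - max a d\<bar> \<le> \<bar>b - d :: real\<bar>"
  by auto

lemma tent_lipschitz:
  assumes "r > 0" shows "\<bar>tent r c x - tent r c y\<bar> \<le> 1 / r\<^sup>2 * \<bar>x - y\<bar>"
proof -
  have "\<bar>tent r c x - tent r c y\<bar> = \<bar>max 0 (1 - \<bar>x - c\<bar> / r) - max 0 (1 - \<bar>y - c\<bar> / r)\<bar> / r"
    using assms by (simp add: tent_def flip: diff_divide_distrib)
  also have "\<dots> \<le> \<bar>(1 - \<bar>x - c\<bar> / r) - (1 - \<bar>y - c\<bar> / r)\<bar> / r"
    using assms by (intro divide_right_mono max_lipschitz) auto
  also have "\<dots> = \<bar>\<bar>y - c\<bar> - \<bar>x - c\<bar>\<bar> / r\<^sup>2"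
    using assms by (simp add: power2_eq_square flip: diff_divide_distrib)
  also have "\<dots> \<le> \<bar>x - y\<bar> / r\<^sup>2"
    using assms by (intro divide_right_mono) auto
  finally show ?thesis by simp
qed

lemma nn_integral_tent:
  assumes "r > 0" shows "(\<integral>\<^sup>+x. ennreal (tent r c x) \<partial>lborel) = 1"
proof -
  let ?g = "\<lambda>u::real. max 0 (1 - \<bar>u\<bar>)"
  have 1: "((\<lambda>u. 1 + u) has_integral (0 + 0\<^sup>2/2) - ((-1) + (-1)\<^sup>2/2)) {-1..0::real}"
    by (rule fundamental_theorem_of_calculus)
       (auto intro!: derivative_eq_intros simp flip: has_real_derivative_iff_has_vector_derivative)
  have 2: "((\<lambda>u. 1 - u) has_integral (1 - 1\<^sup>2/2) - (0 - 0\<^sup>2/2)) {0..1::real}"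
    by (rule fundamental_theorem_of_calculus)
       (auto intro!: derivative_eq_intros simp flip: has_real_derivative_iff_has_vector_derivative)
  have 3: "(?g has_integral 1/2) {-1..0}"
    using 1 by (subst has_integral_cong[where g="\<lambda>u. 1 + u"]) auto
  have 4: "(?g has_integral 1/2) {0..1}"
    using 2 by (subst has_integral_cong[where g="\<lambda>u. 1 - u"]) auto
  have "(?g has_integral 1) {-1..1}"
    using has_integral_combine[OF _ _ 3 4] by simp
  then have "(?g has_integral 1) UNIV"
    by (rule has_integral_on_superset) auto
  then have 5: "(\<integral>\<^sup>+u. ennreal (?g u) \<partial>lborel) = 1"
    by (subst nn_integral_has_integral_lborel) auto
  have "(\<integral>\<^sup>+x. ennreal (tent r c x) \<partial>lborel)
      = ennreal \<bar>r\<bar> * (\<integral>\<^sup>+x. ennreal (tent r c (c + r * x)) \<partial>lborel)"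
    using assms by (subst nn_integral_real_affine[where c=r and t=c]) auto
  also have "\<dots> = (\<integral>\<^sup>+x. ennreal \<bar>r\<bar> * ennreal (tent r c (c + r * x)) \<partial>lborel)"
    by (rule nn_integral_cmult[symmetric]) simp
  also have "\<dots> = (\<integral>\<^sup>+u. ennreal (?g u) \<partial>lborel)"
    using assms by (intro nn_integral_cong) (simp add: tent_def abs_mult flip: ennreal_mult)
  finally show ?thesis using 5 by simp
qed

section \<open>Logarithmic potentials of tents\<close>

lemma nn_integral_ln_0:
  assumes "0 < r" "r \<le> 1"
  shows "(\<integral>\<^sup>+t. ennreal (- ln t) * indicator {0..r} t \<partial>lborel) = ennreal (r * (1 - ln r))"
proof -
  let ?F = "\<lambda>t::real. t - t * ln t"
  let ?f = "\<lambda>t::real. if t \<in> {0..r} then - ln t else 0"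
  have nonpos: "ln t \<le> 0" if "0 \<le> t" "t \<le> r" for t
    using assms that by (cases "t = 0") auto
  have lim: "((\<lambda>t::real. t * ln t) \<longlongrightarrow> 0) (at_right 0)"
    by real_asymp
  \<comment> \<open>The antiderivative is not differentiable at 0. Continuity there, from
    \<open>t * ln t\<close> tending to 0, suffices for the interior form of the fundamental
    theorem.\<close>
  have "continuous_on {0..r} ?F"
  proof (rule continuous_on_eq_continuous_within[THEN iffD2], rule ballI)
    fix t assume t: "t \<in> {0..r}"
    show "continuous (at t within {0..r}) ?F"
    proof (cases "t = 0")
      case True
      have "((\<lambda>t. t * ln t) \<longlongrightarrow> 0) (at 0 within {0..r})"
        using lim assms by (simp add: at_within_Icc_at_right)
      then have "((\<lambda>t. t - t * ln t) \<longlongrightarrow> 0 - 0) (at 0 within {0..r})"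
        by (intro tendsto_diff tendsto_ident_at)
      then show ?thesis using True unfolding continuous_within by simp
    next
      case False
      then show ?thesis using t by (intro continuous_intros) auto
    qed
  qed
  then have "((\<lambda>t. - ln t) has_integral ?F r - ?F 0) {0..r}"
    using assms
    by (intro fundamental_theorem_of_calculus_interior)
       (auto intro!: derivative_eq_intros simp flip: has_real_derivative_iff_has_vector_derivative)
  then have "(?f has_integral ?F r) UNIV"
    by (subst has_integral_restrict_UNIV) simp
  then have "(\<integral>\<^sup>+t. ennreal (?f t) \<partial>lborel) = ennreal (?F r)"
    using nonpos by (intro nn_integral_has_integral_lborel) auto
  also have "(\<integral>\<^sup>+t. ennreal (?f t) \<partial>lborel) = (\<integral>\<^sup>+t. ennreal (- ln t) * indicator {0..r} t \<partial>lborel)"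
    by (intro nn_integral_cong) (auto simp: indicator_def)
  finally show ?thesis by (simp add: algebra_simps)
qed

text \<open>Both sides of \<open>s\<close> are isometric to \<open>{0..r}\<close>, which gives the
  factor 2; the infinite value at \<open>t = s\<close> sits on a null set.\<close>

lemma nn_integral_real_kernel_near:
  assumes "0 < r" "r \<le> 1"
  shows "(\<integral>\<^sup>+t. real_kernel (s, t) * indicator {t. \<bar>s - t\<bar> \<le> r} t \<partial>lborel) \<le> ennreal (2 * r * (1 - ln r))"
proof -
  let ?e = "\<lambda>t. ennreal (- ln t) * indicator {0..r} t"
  have "(\<integral>\<^sup>+t. real_kernel (s, t) * indicator {t. \<bar>s - t\<bar> \<le> r} t \<partial>lborel)
      \<le> (\<integral>\<^sup>+t. ?e (- s + 1 * t) + ?e (s + (- 1) * t) \<partial>lborel)"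
  proof (rule nn_integral_mono_AE)
    show "AE t in lborel. real_kernel (s, t) * indicator {t. \<bar>s - t\<bar> \<le> r} t \<le> ?e (- s + 1 * t) + ?e (s + (-1) * t)"
      using AE_lborel_singleton[of s]
    proof eventually_elim
      case (elim t)
      consider "t < s" | "t > s" using elim by fastforce
      then show ?case
        using assms by cases (auto simp: real_kernel_alt indicator_def max_def)
    qed
  qed
  also have "\<dots> = (\<integral>\<^sup>+t. ?e (- s + 1 * t) \<partial>lborel) + (\<integral>\<^sup>+t. ?e (s + (- 1) * t) \<partial>lborel)"
    by (rule nn_integral_add) auto
  also have "(\<integral>\<^sup>+t. ?e (- s + 1 * t) \<partial>lborel) = (\<integral>\<^sup>+t. ?e t \<partial>lborel)"
    by (subst (2) nn_integral_real_affine[where c=1 and t="-s"]) auto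
  also have "(\<integral>\<^sup>+t. ?e (s + (-1) * t) \<partial>lborel) = (\<integral>\<^sup>+t. ?e t \<partial>lborel)"
    by (subst (2) nn_integral_real_affine[where c="-1" and t="s"]) auto
  also have "(\<integral>\<^sup>+t. ?e t \<partial>lborel) + (\<integral>\<^sup>+t. ?e t \<partial>lborel) = ennreal (2 * r * (1 - ln r))"
  proof -
    have "0 \<le> r * (1 - ln r)" using assms by (intro mult_nonneg_nonneg) (auto intro: order_trans[of _ 0])
    then show ?thesis
      using assms by (simp only: nn_integral_ln_0) (simp flip: ennreal_plus)
  qed
  finally show ?thesis .
qed

text \<open>Splitting at distance \<open>r\<close>: far away the kernel is at most \<open>- ln r\<close>, and near \<open>s\<close> the
  tent is at most \<open>1 / r\<close>.\<close>

lemma tent_potential: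
  assumes "0 < r" "r \<le> 1"
  shows "(\<integral>\<^sup>+t. ennreal (tent r c t) * real_kernel (s, t) \<partial>lborel) \<le> ennreal (2 - 3 * ln r)"
proof -
  have ln: "ln r \<le> 0" using assms by simp
  have "ennreal (tent r c t) * real_kernel (s, t)
      \<le> ennreal (- ln r) * ennreal (tent r c t) + ennreal (1/r) * (real_kernel (s, t) * indicator {t. \<bar>s - t\<bar> \<le> r} t)" for t
  proof (cases "\<bar>s - t\<bar> \<le> r")
    case True
    have "ennreal (tent r c t) * real_kernel (s, t) \<le> ennreal (1/r) * real_kernel (s, t)"
      using assms by (intro mult_right_mono ennreal_leI tent_le) auto
    then show ?thesis using True by (simp add: add_increasing)
  next
    case False
    then have "ln r \<le> ln \<bar>s - t\<bar>" using assms by simp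
    then have "real_kernel (s, t) \<le> ennreal (- ln r)"
      using False ln assms by (auto simp: real_kernel_alt intro!: ennreal_leI)
    then have "ennreal (tent r c t) * real_kernel (s, t) \<le> ennreal (tent r c t) * ennreal (- ln r)"
      by (intro mult_left_mono) auto
    then show ?thesis using False by (simp add: mult.commute)
  qed
  then have "(\<integral>\<^sup>+t. ennreal (tent r c t) * real_kernel (s, t) \<partial>lborel)
      \<le> (\<integral>\<^sup>+t. ennreal (- ln r) * ennreal (tent r c t) + ennreal (1/r) * (real_kernel (s, t) * indicator {t. \<bar>s - t\<bar> \<le> r} t) \<partial>lborel)"
    by (intro nn_integral_mono)
  also have "\<dots> = (\<integral>\<^sup>+t. ennreal (- ln r) * ennreal (tent r c t) \<partial>lborel)
      + (\<integral>\<^sup>+t. ennreal (1/r) * (real_kernel (s, t) * indicator {t. \<bar>s - t\<bar> \<le> r} t) \<partial>lborel)"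
    by (rule nn_integral_add) measurable
  also have "(\<integral>\<^sup>+t. ennreal (- ln r) * ennreal (tent r c t) \<partial>lborel) = ennreal (- ln r)"
    using assms by (subst nn_integral_cmult) (auto simp: nn_integral_tent)
  also have "(\<integral>\<^sup>+t. ennreal (1/r) * (real_kernel (s, t) * indicator {t. \<bar>s - t\<bar> \<le> r} t) \<partial>lborel)
      = ennreal (1/r) * (\<integral>\<^sup>+t. real_kernel (s, t) * indicator {t. \<bar>s - t\<bar> \<le> r} t \<partial>lborel)"
    by (rule nn_integral_cmult) measurable
  also have "\<dots> \<le> ennreal (1/r) * ennreal (2 * r * (1 - ln r))"
    using assms by (intro mult_left_mono nn_integral_real_kernel_near) auto
  also have "\<dots> = ennreal (2 * (1 - ln r))"
    using assms by (simp flip: ennreal_mult')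
  also have "ennreal (- ln r) + \<dots> = ennreal (2 - 3 * ln r)"
    using ln by (simp flip: ennreal_plus)
  finally show ?thesis by simp
qed

text \<open>The potential bound for one tent is uniform in \<open>s\<close>, and the other tent is a
  probability density, so averaging over it costs nothing. With equal tents this bounds the
  self-energy.\<close>

lemma tent_interaction:
  assumes "0 < r" "r \<le> 1" "0 < r'"
  shows "(\<integral>\<^sup>+p. ennreal (tent r' c' (fst p)) * ennreal (tent r c (snd p)) * real_kernel p \<partial>(lborel \<Otimes>\<^sub>M lborel))
    \<le> ennreal (2 - 3 * ln r)"
proof -
  have "(\<integral>\<^sup>+p. ennreal (tent r' c' (fst p)) * ennreal (tent r c (snd p)) * real_kernel p \<partial>(lborel \<Otimes>\<^sub>M lborel))
    = (\<integral>\<^sup>+x. \<integral>\<^sup>+y. ennreal (tent r' c' x) * (ennreal (tent r c y) * real_kernel (x, y)) \<partial>lborel \<partial>lborel)"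
    by (subst lborel.nn_integral_fst[symmetric]) (auto simp: mult.assoc)
  also have "\<dots> = (\<integral>\<^sup>+x. ennreal (tent r' c' x) * (\<integral>\<^sup>+y. ennreal (tent r c y) * real_kernel (x, y) \<partial>lborel) \<partial>lborel)"
    by (intro nn_integral_cong nn_integral_cmult) measurable
  also have "\<dots> \<le> (\<integral>\<^sup>+x. ennreal (tent r' c' x) * ennreal (2 - 3 * ln r) \<partial>lborel)"
    using assms by (intro nn_integral_mono mult_left_mono tent_potential) auto
  also have "\<dots> = ennreal (2 - 3 * ln r)"
    using assms by (subst nn_integral_multc) (auto simp: nn_integral_tent)
  finally show ?thesis .
qed

section \<open>The second moment of a random density\<close>

lemma dens_energy_cmult:
  assumes [measurable]: "h \<in> borel_measurable borel" and "a \<ge> 0" "\<And>x. h x \<ge> 0"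
  shows "dens_energy (\<lambda>x. a * h x) = ennreal (a\<^sup>2) * dens_energy h"
proof -
  have "dens_energy (\<lambda>x. a * h x)
      = (\<integral>\<^sup>+p. ennreal (a\<^sup>2) * (ennreal (h (fst p)) * ennreal (h (snd p)) * real_kernel p) \<partial>(lborel \<Otimes>\<^sub>M lborel))"
    unfolding dens_energy_def using assms
    by (intro nn_integral_cong) (simp add: ennreal_mult power2_eq_square mult_ac)
  also have "\<dots> = ennreal (a\<^sup>2) * dens_energy h"
    unfolding dens_energy_def by (rule nn_integral_cmult) measurable
  finally show ?thesis .
qed

lemma dens_energy_mono: "(\<And>x. h x \<le> h' x) \<Longrightarrow> dens_energy h \<le> dens_energy h'"
  unfolding dens_energy_def by (intro nn_integral_mono mult_mono ennreal_leI) auto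

lemma sigma_finite_lborel_pair: "sigma_finite_measure ((lborel :: real measure) \<Otimes>\<^sub>M (lborel :: real measure))"
  by (rule sigma_finite_pair_measure) (auto simp: lborel.sigma_finite_measure_axioms)

lemma nn_integral_swap_pair:
  assumes "sigma_finite_measure N"
    and [measurable]: "case_prod G \<in> borel_measurable (N \<Otimes>\<^sub>M (lborel \<Otimes>\<^sub>M lborel))"
  shows "(\<integral>\<^sup>+w. \<integral>\<^sup>+p. G w p \<partial>(lborel \<Otimes>\<^sub>M lborel) \<partial>N)
    = (\<integral>\<^sup>+p. \<integral>\<^sup>+w. G w p \<partial>N \<partial>((lborel :: real measure) \<Otimes>\<^sub>M (lborel :: real measure)))"
proof -
  interpret N: sigma_finite_measure N by fact
  interpret L: sigma_finite_measure "(lborel :: real measure) \<Otimes>\<^sub>M (lborel :: real measure)"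
    by (rule sigma_finite_lborel_pair)
  interpret P: pair_sigma_finite N "(lborel :: real measure) \<Otimes>\<^sub>M (lborel :: real measure)" ..
  show ?thesis by (rule P.Fubini'[symmetric]) fact
qed

section \<open>Random points and the densities built on them\<close>

locale random_points = prob_space M for M :: "'a measure" +
  fixes c :: "nat \<Rightarrow> 'a \<Rightarrow> real" and f :: "real \<Rightarrow> ennreal" and lam B :: real
  assumes lam_pos: "lam > 0"
    and indep: "indep_vars (\<lambda>_. borel) c {1..}"
    and distr: "\<And>k. k \<ge> 1 \<Longrightarrow> distributed M lborel (c k) f"
    and f_bound: "\<And>x. f x \<le> ennreal B"
    and f_pos: "AE x in lborel. x \<in> {0..1} \<longrightarrow> f x > 0"
begin

text \<open>A quarter of the length of the \<open>k\<close>-th interval: the closed support of a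
  tent of radius \<open>rad k\<close> fits into the open interval of half-length
  \<open>2 * rad k\<close>.\<close>

definition rad :: "nat \<Rightarrow> real" where "rad k = exp (- lam * real k) / 4"

text \<open>The centres enter as a sequence \<open>v\<close> and not through the sample point, so
  that success of a block is an event about the coordinates in \<open>A\<close> alone.\<close>

definition mass :: "(real \<Rightarrow> real) \<Rightarrow> nat set \<Rightarrow> (nat \<Rightarrow> real) \<Rightarrow> real" where
  "mass g A v = (\<Sum>k\<in>A. g (v k) / real k)"

definition dens :: "(real \<Rightarrow> real) \<Rightarrow> nat set \<Rightarrow> (nat \<Rightarrow> real) \<Rightarrow> real \<Rightarrow> real" where
  "dens g A v x = (\<Sum>k\<in>A. g (v k) / real k * tent (rad k) (v k) x)"

lemma rad_pos: "rad k > 0" and rad_le_1: "rad k \<le> 1"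
  and rad_antimono: "j \<le> k \<Longrightarrow> rad k \<le> rad j"
proof -
  show "rad k > 0" by (simp add: rad_def)
  have "exp (- lam * real k) \<le> 1" using lam_pos by simp
  then show "rad k \<le> 1" unfolding rad_def by linarith
  show "j \<le> k \<Longrightarrow> rad k \<le> rad j" using lam_pos by (simp add: rad_def)
qed

text \<open>Taking the logarithm of the exponential radius leaves a bound linear in
  \<open>k\<close>; since \<open>1 \<le> k\<close>, the additive constants can be absorbed into the
  slope. This is the origin of \<open>2 + 3 * ln 4 + 3 * lam\<close> below.\<close>

lemma rad_ln: "k \<ge> 1 \<Longrightarrow> 2 - 3 * ln (rad k) \<le> (2 + 3 * ln 4 + 3 * lam) * real k"
proof -
  assume "k \<ge> 1"
  then have k: "1 \<le> real k" by simp
  have "2 - 3 * ln (rad k) = (2 + 3 * ln 4) * 1 + 3 * lam * real k"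
    by (simp add: rad_def ln_div)
  also have "\<dots> \<le> (2 + 3 * ln 4) * real k + 3 * lam * real k"
    using k by (intro add_right_mono mult_left_mono) auto
  finally show ?thesis by (simp add: algebra_simps)
qed

lemma c_measurable: "k \<ge> 1 \<Longrightarrow> c k \<in> borel_measurable M"
  using distributed_measurable[OF distr, of k] by simp

lemma f_measurable [measurable]: "f \<in> borel_measurable borel"
  using distributed_borel_measurable[OF distr, of 1] by simp

lemma dens_nonneg: "(\<And>x. 0 \<le> g x) \<Longrightarrow> 0 \<le> dens g A v x"
  unfolding dens_def by (intro sum_nonneg mult_nonneg_nonneg divide_nonneg_nonneg tent_nonneg rad_pos) auto

lemma mass_nonneg: "(\<And>x. 0 \<le> g x) \<Longrightarrow> 0 \<le> mass g A v"
  unfolding mass_def by (intro sum_nonneg divide_nonneg_nonneg) auto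

text \<open>The space \<open>N\<close> is left open because two are needed: \<open>M\<close> for
  expectations and the product over one block for independence.\<close>

lemma dens_energy_dens_measurable:
  assumes [measurable]: "g \<in> borel_measurable borel"
    and F[measurable]: "\<And>k. k \<in> A \<Longrightarrow> (\<lambda>w. F w k) \<in> borel_measurable N"
  shows "(\<lambda>w. dens_energy (dens g A (F w))) \<in> borel_measurable N"
proof -
  have [measurable]: "(\<lambda>z. dens g A (F (fst z)) (fst (snd z))) \<in> borel_measurable (N \<Otimes>\<^sub>M (lborel \<Otimes>\<^sub>M lborel))"
    "(\<lambda>z. dens g A (F (fst z)) (snd (snd z))) \<in> borel_measurable (N \<Otimes>\<^sub>M (lborel \<Otimes>\<^sub>M lborel))"
    unfolding dens_def by measurable
  show ?thesis unfolding dens_energy_def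
    by (rule sigma_finite_measure.borel_measurable_nn_integral[OF sigma_finite_lborel_pair]) (simp add: case_prod_beta')
qed

lemma mass_measurable:
  assumes [measurable]: "g \<in> borel_measurable borel"
    and F[measurable]: "\<And>k. k \<in> A \<Longrightarrow> (\<lambda>w. F w k) \<in> borel_measurable N"
  shows "(\<lambda>w. mass g A (F w)) \<in> borel_measurable N"
  unfolding mass_def by measurable

text \<open>Off the diagonal independence decouples the two factors; on it, the weights \<open>1 / k\<close>
  turn \<open>- ln (rad k) = O(k)\<close> into a contribution of order \<open>\<Sum>k\<in>A. 1 / k\<close>.\<close>

lemma expected_energy:
  assumes A: "finite A" "A \<subseteq> {1..}"
    and g[measurable]: "g \<in> borel_measurable borel" and g0: "\<And>x. 0 \<le> g x" and gK: "\<And>x. g x \<le> K"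
    and h[measurable]: "h \<in> borel_measurable borel"
    and sub: "\<And>k x. k \<in> A \<Longrightarrow> (\<integral>\<^sup>+t. f t * ennreal (g t * tent (rad k) t x) \<partial>lborel) \<le> ennreal (h x)"
  defines "H \<equiv> (\<Sum>k\<in>A. 1 / real k)"
  shows "(\<integral>\<^sup>+w. dens_energy (dens g A (\<lambda>k. c k w)) \<partial>M)
      \<le> ennreal (H\<^sup>2) * dens_energy h + ennreal (K\<^sup>2 * (2 + 3 * ln 4 + 3 * lam) * H)"
proof -
  let ?C = "2 + 3 * ln 4 + 3 * lam"
  have C0: "0 \<le> ?C" using lam_pos by simp
  have K0: "0 \<le> K" using g0[of 0] gK[of 0] by linarith
  have cm[measurable]: "\<And>k. k \<in> A \<Longrightarrow> c k \<in> borel_measurable M" using A c_measurable by auto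
  define u where "u k w x = ennreal (g (c k w) * tent (rad k) (c k w) x)" for k w x
  define b where "b j k w = (\<integral>\<^sup>+p. u j w (fst p) * u k w (snd p) * real_kernel p \<partial>(lborel \<Otimes>\<^sub>M lborel))" for j k w
  have um[measurable]: "(\<lambda>z. u k (fst z) (snd z)) \<in> borel_measurable (M \<Otimes>\<^sub>M borel)" if "k \<in> A" for k
    unfolding u_def using that by measurable
  have um1: "(\<lambda>z. u k (fst z) (fst (snd z))) \<in> borel_measurable (M \<Otimes>\<^sub>M (lborel \<Otimes>\<^sub>M lborel))"
    and um2: "(\<lambda>z. u k (fst z) (snd (snd z))) \<in> borel_measurable (M \<Otimes>\<^sub>M (lborel \<Otimes>\<^sub>M lborel))"
    and um3[measurable]: "u k w \<in> borel_measurable borel"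
    and um4: "(\<lambda>w. u k w x) \<in> borel_measurable M" if "k \<in> A" for k w x
    unfolding u_def using that by measurable
  note um1[measurable] um2[measurable] um4[measurable]
  have bm[measurable]: "(\<lambda>w. b j k w) \<in> borel_measurable M" if [measurable]: "j \<in> A" "k \<in> A" for j k
  proof -
    show ?thesis unfolding b_def
      by (rule sigma_finite_measure.borel_measurable_nn_integral[OF sigma_finite_lborel_pair]) (simp add: case_prod_beta')
  qed
  have expand: "dens_energy (dens g A (\<lambda>k. c k w)) = (\<Sum>j\<in>A. \<Sum>k\<in>A. ennreal (1 / real j * (1 / real k)) * b j k w)" for w
  proof -
    have d: "ennreal (dens g A (\<lambda>k. c k w) x) = (\<Sum>k\<in>A. ennreal (1 / real k) * u k w x)" for x
      unfolding dens_def
      by (subst sum_ennreal[symmetric])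
         (auto simp: g0 tent_nonneg rad_pos u_def simp flip: ennreal_mult intro!: sum.cong)
    have "dens_energy (dens g A (\<lambda>k. c k w))
      = (\<integral>\<^sup>+p. (\<Sum>j\<in>A. \<Sum>k\<in>A. ennreal (1 / real j * (1 / real k)) * (u j w (fst p) * u k w (snd p) * real_kernel p)) \<partial>(lborel \<Otimes>\<^sub>M lborel))"
      unfolding dens_energy_def d
      unfolding sum_product sum_distrib_right
      by (intro nn_integral_cong sum.cong refl)
         (simp only: sum_distrib_left sum_distrib_right, intro sum.cong refl, subst ennreal_mult, simp_all add: mult_ac)
    also have "\<dots> = (\<Sum>j\<in>A. \<Sum>k\<in>A. ennreal (1 / real j * (1 / real k)) * b j k w)"
      unfolding b_def
      by (subst nn_integral_sum, measurable, intro sum.cong refl,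
          subst nn_integral_sum, measurable, intro sum.cong refl nn_integral_cmult, measurable)
    finally show ?thesis .
  qed
  have diag: "b k k w \<le> ennreal (K\<^sup>2 * (?C * real k))" if k: "k \<in> A" for k w
  proof -
    have ub: "u k w x \<le> ennreal K * ennreal (tent (rad k) (c k w) x)" for x
      unfolding u_def using K0 by (subst ennreal_mult[symmetric]) (auto intro!: ennreal_leI mult_right_mono gK tent_nonneg rad_pos)
    have "b k k w \<le> (\<integral>\<^sup>+p. ennreal K * ennreal (tent (rad k) (c k w) (fst p)) * (ennreal K * ennreal (tent (rad k) (c k w) (snd p))) * real_kernel p \<partial>(lborel \<Otimes>\<^sub>M lborel))"
      unfolding b_def by (intro nn_integral_mono mult_mono ub) auto
    also have "\<dots> = (\<integral>\<^sup>+p. ennreal (K\<^sup>2) * (ennreal (tent (rad k) (c k w) (fst p)) * ennreal (tent (rad k) (c k w) (snd p)) * real_kernel p) \<partial>(lborel \<Otimes>\<^sub>M lborel))"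
      using K0 by (intro nn_integral_cong) (simp add: power2_eq_square ennreal_mult mult_ac)
    also have "\<dots> = ennreal (K\<^sup>2) * (\<integral>\<^sup>+p. (ennreal (tent (rad k) (c k w) (fst p)) * ennreal (tent (rad k) (c k w) (snd p)) * real_kernel p) \<partial>(lborel \<Otimes>\<^sub>M lborel))"
      by (rule nn_integral_cmult) measurable
    also have "\<dots> \<le> ennreal (K\<^sup>2) * ennreal (2 - 3 * ln (rad k))"
      by (intro mult_left_mono tent_interaction rad_pos rad_le_1) auto
    also have "\<dots> \<le> ennreal (K\<^sup>2) * ennreal (?C * real k)"
      using k A by (intro mult_left_mono ennreal_leI rad_ln) auto
    also have "\<dots> = ennreal (K\<^sup>2 * (?C * real k))"
      using C0 by (simp add: ennreal_mult)
    finally show ?thesis .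
  qed
  have marg: "(\<integral>\<^sup>+w. u k w x \<partial>M) \<le> ennreal (h x)" if k: "k \<in> A" for k x
  proof -
    have "(\<integral>\<^sup>+w. u k w x \<partial>M) = (\<integral>\<^sup>+t. f t * ennreal (g t * tent (rad k) t x) \<partial>lborel)"
      unfolding u_def using k A by (subst distributed_nn_integral[OF distr]) auto
    then show ?thesis using sub[OF k] by simp
  qed
  have off: "(\<integral>\<^sup>+w. b j k w \<partial>M) \<le> dens_energy h" if jk: "j \<in> A" "k \<in> A" "j \<noteq> k" for j k
  proof -
    note [measurable] = jk(1,2)
    have prod: "(\<integral>\<^sup>+w. u j w x * u k w y \<partial>M) = (\<integral>\<^sup>+w. u j w x \<partial>M) * (\<integral>\<^sup>+w. u k w y \<partial>M)" for x y
    proof -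
      \<comment> \<open>Both factors are packed into one family indexed by \<open>{j, k}\<close>,
        the form in which independence splits an integral of a product; \<open>j \<noteq> k\<close>
        makes the case distinction unambiguous.\<close>
      let ?Y = "\<lambda>i t. ennreal (g t * tent (rad i) t (if i = j then x else y))"
      have "indep_vars (\<lambda>_. borel) c {j, k}"
        using A jk by (intro indep_vars_subset[OF indep]) auto
      then have "indep_vars (\<lambda>_. borel) (\<lambda>i w. ?Y i (c i w)) {j, k}"
        by (rule indep_vars_compose2) measurable
      then have "(\<integral>\<^sup>+w. (\<Prod>i\<in>{j,k}. ?Y i (c i w)) \<partial>M) = (\<Prod>i\<in>{j,k}. \<integral>\<^sup>+w. ?Y i (c i w) \<partial>M)"
        by (intro indep_vars_nn_integral) auto
      then show ?thesis using jk(3) by (simp add: u_def)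
    qed
    have "(\<integral>\<^sup>+w. b j k w \<partial>M)
        = (\<integral>\<^sup>+p. (\<integral>\<^sup>+w. u j w (fst p) * u k w (snd p) * real_kernel p \<partial>M) \<partial>(lborel \<Otimes>\<^sub>M lborel))"
      unfolding b_def
      by (rule nn_integral_swap_pair) (auto simp: case_prod_beta' intro: sigma_finite_measure_axioms)
    also have "\<dots> = (\<integral>\<^sup>+p. (\<integral>\<^sup>+w. u j w (fst p) \<partial>M) * (\<integral>\<^sup>+w. u k w (snd p) \<partial>M) * real_kernel p \<partial>(lborel \<Otimes>\<^sub>M lborel))"
      by (subst nn_integral_multc) (auto simp: prod)
    also have "\<dots> \<le> dens_energy h"
      unfolding dens_energy_def using jk by (intro nn_integral_mono mult_mono marg) auto
    finally show ?thesis .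
  qed
  have "(\<integral>\<^sup>+w. dens_energy (dens g A (\<lambda>k. c k w)) \<partial>M)
      = (\<Sum>j\<in>A. \<Sum>k\<in>A. ennreal (1 / real j * (1 / real k)) * (\<integral>\<^sup>+w. b j k w \<partial>M))"
    unfolding expand
    by (subst nn_integral_sum, measurable, intro sum.cong refl,
          subst nn_integral_sum, measurable, intro sum.cong refl nn_integral_cmult, measurable)
  \<comment> \<open>The diagonal terms are also given a summand \<open>dens_energy h\<close>. It
    only enlarges the bound and completes the double sum of weights to the square of
    \<open>H\<close>.\<close>
  also have "\<dots> \<le> (\<Sum>j\<in>A. \<Sum>k\<in>A. ennreal (1 / real j * (1 / real k)) * (dens_energy h + (if j = k then ennreal (K\<^sup>2 * (?C * real k)) else 0)))"
  proof (intro sum_mono mult_left_mono)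
    fix j k assume jk: "j \<in> A" "k \<in> A"
    show "(\<integral>\<^sup>+w. b j k w \<partial>M) \<le> dens_energy h + (if j = k then ennreal (K\<^sup>2 * (?C * real k)) else 0)"
    proof (cases "j = k")
      case True
      have "(\<integral>\<^sup>+w. b k k w \<partial>M) \<le> (\<integral>\<^sup>+w. ennreal (K\<^sup>2 * (?C * real k)) \<partial>M)"
        using jk by (intro nn_integral_mono diag)
      then show ?thesis using True by (simp add: emeasure_space_1 add_increasing)
    qed (use off jk in auto)
  qed auto
  also have "\<dots> = (\<Sum>j\<in>A. \<Sum>k\<in>A. ennreal (1 / real j * (1 / real k))) * dens_energy h
      + (\<Sum>j\<in>A. ennreal (1 / real j * (1 / real j)) * ennreal (K\<^sup>2 * (?C * real j)))"
  proof -
    have "(\<Sum>k\<in>A. ennreal (1 / real j * (1 / real k)) * (if j = k then ennreal (K\<^sup>2 * (?C * real k)) else 0))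
      = ennreal (1 / real j * (1 / real j)) * ennreal (K\<^sup>2 * (?C * real j))" if "j \<in> A" for j
      using that A by (subst sum.remove[of _ j]) (auto intro!: sum.neutral)
    then show ?thesis
      by (simp add: distrib_left sum.distrib sum_distrib_right del: sum_ennreal)
  qed
  also have "(\<Sum>j\<in>A. \<Sum>k\<in>A. ennreal (1 / real j * (1 / real k))) = ennreal (H\<^sup>2)"
    unfolding H_def power2_eq_square sum_product by (simp add: sum_nonneg)
  also have "(\<Sum>j\<in>A. ennreal (1 / real j * (1 / real j)) * ennreal (K\<^sup>2 * (?C * real j)))
      = (\<Sum>j\<in>A. ennreal (K\<^sup>2 * ?C * (1 / real j)))"
    using A C0 by (intro sum.cong refl) (auto simp: divide_simps simp flip: ennreal_mult)
  also have "\<dots> = ennreal (K\<^sup>2 * ?C * H)"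
    unfolding H_def using C0 by (subst sum_ennreal) (auto simp: sum_distrib_left)
  finally show ?thesis .
qed

text \<open>With \<open>Z\<close> the mass of the random density and \<open>X\<close> its energy, \<open>e Z\<^sup>2 \<le> X\<close> off the good event
  and \<open>Z \<le> K H\<close> on it; take expectations and use \<open>(E Z)\<^sup>2 \<le> E Z\<^sup>2\<close>.\<close>

lemma good_block_prob:
  assumes A: "finite A" "A \<subseteq> {1..}"
    and g[measurable]: "g \<in> borel_measurable borel" and g0: "\<And>x. 0 \<le> g x" and gK: "\<And>x. g x \<le> K"
    and h[measurable]: "h \<in> borel_measurable borel"
    and sub: "\<And>k x. k \<in> A \<Longrightarrow> (\<integral>\<^sup>+t. f t * ennreal (g t * tent (rad k) t x) \<partial>lborel) \<le> ennreal (h x)"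
    and m: "(\<integral>\<^sup>+t. f t * ennreal (g t) \<partial>lborel) = ennreal m" "m \<ge> 0"
    and E: "dens_energy h = ennreal E" "E \<ge> 0" and e: "e > 0"
  defines "H \<equiv> (\<Sum>k\<in>A. 1 / real k)"
  shows "e * m\<^sup>2 * H\<^sup>2 \<le> E * H\<^sup>2 + K\<^sup>2 * (2 + 3 * ln 4 + 3 * lam) * H
    + e * K\<^sup>2 * H\<^sup>2 * prob {w\<in>space M. dens_energy (dens g A (\<lambda>k. c k w)) < ennreal (e * (mass g A (\<lambda>k. c k w))\<^sup>2)}"
proof -
  let ?C = "2 + 3 * ln 4 + 3 * lam"
  define Z where "Z w = mass g A (\<lambda>k. c k w)" for w
  define X where "X w = dens_energy (dens g A (\<lambda>k. c k w))" for w
  define G where "G = {w\<in>space M. X w < ennreal (e * (Z w)\<^sup>2)}"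
  have C0: "0 \<le> ?C" using lam_pos by simp
  have K0: "0 \<le> K" using g0[of 0] gK[of 0] by linarith
  have H0: "0 \<le> H" unfolding H_def by (intro sum_nonneg) auto
  have cm[measurable]: "\<And>k. k \<in> A \<Longrightarrow> c k \<in> borel_measurable M" using A c_measurable by auto
  have [measurable]: "Z \<in> borel_measurable M" "X \<in> borel_measurable M"
    unfolding Z_def X_def by (auto intro!: mass_measurable dens_energy_dens_measurable g)
  then have Gm[measurable]: "G \<in> events" unfolding G_def by measurable
  have Z0: "0 \<le> Z w" for w unfolding Z_def using g0 by (rule mass_nonneg)
  have ZK: "Z w \<le> K * H" for w
  proof -
    have "Z w \<le> (\<Sum>k\<in>A. K / real k)"
      unfolding Z_def mass_def by (intro sum_mono divide_right_mono gK) auto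
    then show ?thesis unfolding H_def by (simp add: sum_distrib_left)
  qed
  have Zi: "integrable M Z"
    by (rule integrable_const_bound[where B="K * H"]) (use Z0 ZK in auto)
  have Z2le: "(Z w)\<^sup>2 \<le> (K * H)\<^sup>2" for w
    using Z0 ZK by (intro power_mono) auto
  have Z2i: "integrable M (\<lambda>w. (Z w)\<^sup>2)"
    by (rule integrable_const_bound[where B="(K * H)\<^sup>2"]) (use Z2le in auto)
  have EZ: "expectation Z = H * m"
  proof -
    have "ennreal (expectation Z) = (\<integral>\<^sup>+w. ennreal (Z w) \<partial>M)"
      using Zi Z0 by (subst nn_integral_eq_integral) auto
    also have "\<dots> = (\<integral>\<^sup>+w. (\<Sum>k\<in>A. ennreal (1 / real k) * ennreal (g (c k w))) \<partial>M)"
      unfolding Z_def mass_def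
      by (intro nn_integral_cong, subst sum_ennreal[symmetric]) (auto simp: g0 simp flip: ennreal_mult)
    also have "\<dots> = (\<Sum>k\<in>A. ennreal (1 / real k) * (\<integral>\<^sup>+w. ennreal (g (c k w)) \<partial>M))"
      by (subst nn_integral_sum, measurable, intro sum.cong refl nn_integral_cmult, measurable)
    also have "\<dots> = (\<Sum>k\<in>A. ennreal (1 / real k) * ennreal m)"
    proof (intro sum.cong refl)
      fix k assume "k \<in> A"
      then have "k \<ge> 1" using A by auto
      then have "(\<integral>\<^sup>+w. ennreal (g (c k w)) \<partial>M) = (\<integral>\<^sup>+t. f t * ennreal (g t) \<partial>lborel)"
        by (subst distributed_nn_integral[OF distr]) auto
      then show "ennreal (1 / real k) * (\<integral>\<^sup>+w. ennreal (g (c k w)) \<partial>M) = ennreal (1 / real k) * ennreal m"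
        using m by simp
    qed
    also have "\<dots> = ennreal (H * m)"
      unfolding H_def sum_distrib_right using m(2) by (subst sum_ennreal[symmetric]) (auto simp flip: ennreal_mult)
    finally show ?thesis
      using m(2) H0 by (subst (asm) ennreal_inj) (auto intro!: integral_nonneg_AE Z0)
  qed
  have "0 \<le> variance Z" by (rule variance_positive)
  also have "variance Z = expectation (\<lambda>w. (Z w)\<^sup>2) - (H * m)\<^sup>2"
    using variance_eq[OF Zi Z2i] EZ by simp
  finally have "e * (H * m)\<^sup>2 \<le> e * expectation (\<lambda>w. (Z w)\<^sup>2)" using e by simp
  then have "ennreal (e * (H * m)\<^sup>2) \<le> ennreal (expectation (\<lambda>w. e * (Z w)\<^sup>2))"
    by (intro ennreal_leI) simp
  also have "\<dots> = (\<integral>\<^sup>+w. ennreal (e * (Z w)\<^sup>2) \<partial>M)"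
    using Z2i e by (subst nn_integral_eq_integral) auto
  also have "\<dots> \<le> (\<integral>\<^sup>+w. X w + ennreal (e * (K * H)\<^sup>2) * indicator G w \<partial>M)"
  proof (intro nn_integral_mono)
    fix w assume w: "w \<in> space M"
    show "ennreal (e * (Z w)\<^sup>2) \<le> X w + ennreal (e * (K * H)\<^sup>2) * indicator G w"
    proof (cases "w \<in> G")
      case True
      have "ennreal (e * (Z w)\<^sup>2) \<le> ennreal (e * (K * H)\<^sup>2)"
        using e Z2le by (intro ennreal_leI mult_left_mono) auto
      then show ?thesis using True by (simp add: add_increasing)
    qed (use w in \<open>auto simp: G_def not_less\<close>)
  qed
  also have "\<dots> = (\<integral>\<^sup>+w. X w \<partial>M) + (\<integral>\<^sup>+w. ennreal (e * (K * H)\<^sup>2) * indicator G w \<partial>M)"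
    by (rule nn_integral_add) measurable
  also have "(\<integral>\<^sup>+w. ennreal (e * (K * H)\<^sup>2) * indicator G w \<partial>M) = ennreal (e * (K * H)\<^sup>2 * prob G)"
    using e by (simp add: nn_integral_cmult_indicator emeasure_eq_measure ennreal_mult)
  also have "(\<integral>\<^sup>+w. X w \<partial>M) + ennreal (e * (K * H)\<^sup>2 * prob G)
      \<le> ennreal (H\<^sup>2) * dens_energy h + ennreal (K\<^sup>2 * ?C * H) + ennreal (e * (K * H)\<^sup>2 * prob G)"
    unfolding X_def H_def by (intro add_right_mono expected_energy[OF A g g0 gK h sub])
  also have "ennreal (H\<^sup>2) * dens_energy h + ennreal (K\<^sup>2 * ?C * H) + ennreal (e * (K * H)\<^sup>2 * prob G)
      = ennreal (H\<^sup>2 * E + K\<^sup>2 * ?C * H + e * (K * H)\<^sup>2 * prob G)"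
    unfolding E using E(2) C0 H0 e by (simp add: ennreal_mult ennreal_plus)
  finally have "e * (H * m)\<^sup>2 \<le> H\<^sup>2 * E + K\<^sup>2 * ?C * H + e * (K * H)\<^sup>2 * prob G"
    using E(2) C0 H0 e by (subst (asm) ennreal_le_iff) auto
  then show ?thesis unfolding G_def X_def Z_def by (simp add: power_mult_distrib mult_ac)
qed

end

section \<open>Refining a fixed density\<close>

text \<open>This class is closed under refinement. The Lipschitz constant is not part of the data,
  as it grows without control from one refinement to the next.\<close>

definition lip_density :: "(real \<Rightarrow> real) \<Rightarrow> bool" where
  "lip_density h \<longleftrightarrow> (\<exists>L. \<forall>x y. \<bar>h x - h y\<bar> \<le> L * \<bar>x - y\<bar>) \<and> (\<forall>x. 0 \<le> h x)
     \<and> (\<forall>x. x \<notin> {0..1} \<longrightarrow> h x = 0) \<and> (\<integral>\<^sup>+x. ennreal (h x) \<partial>lborel) = 1"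

lemma lipschitz_real_measurable:
  fixes h :: "real \<Rightarrow> real"
  assumes "\<And>x y. \<bar>h x - h y\<bar> \<le> L * \<bar>x - y\<bar>"
  shows "h \<in> borel_measurable borel"
proof -
  have "(max L 0)-lipschitz_on UNIV h"
  proof (rule lipschitz_onI)
    fix x y :: real
    have "L * \<bar>x - y\<bar> \<le> max L 0 * \<bar>x - y\<bar>" by (intro mult_right_mono) auto
    then show "dist (h x) (h y) \<le> max L 0 * dist x y"
      using assms[of x y] by (simp add: dist_real_def)
  qed simp
  then show ?thesis
    by (intro borel_measurable_continuous_onI lipschitz_on_continuous_on)
qed

lemma lip_density_measurable: "lip_density h \<Longrightarrow> h \<in> borel_measurable borel"
  unfolding lip_density_def by (auto intro: lipschitz_real_measurable)

lemma lip_density_obtain: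
  assumes "lip_density h"
  obtains L where "L > 0" "\<And>x y. \<bar>h x - h y\<bar> \<le> L * \<bar>x - y\<bar>"
proof -
  from assms obtain L where L: "\<And>x y. \<bar>h x - h y\<bar> \<le> L * \<bar>x - y\<bar>"
    unfolding lip_density_def by blast
  have "\<bar>h x - h y\<bar> \<le> (max L 0 + 1) * \<bar>x - y\<bar>" for x y
    using L[of x y] mult_right_mono[of L "max L 0 + 1" "\<bar>x - y\<bar>"] by linarith
  then show thesis using that[of "max L 0 + 1"] by auto
qed

text \<open>The tail unions decrease and each has probability at least \<open>p\<close>, so the
  limsup event does too; the zero-one law then lifts its probability to 1.\<close>

lemma (in prob_space) AE_some_indep_event:
  fixes F :: "nat \<Rightarrow> 'a set"
  assumes F: "indep_events F UNIV" and p: "p > 0" "\<And>i. p \<le> prob (F i)"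
  shows "AE w in M. \<exists>i. w \<in> F i"
proof -
  have Fm[measurable]: "F i \<in> events" for i using F by (auto simp: indep_events_def)
  let ?U = "\<lambda>n. \<Union>m\<in>{n..}. F m"
  have "(\<lambda>n. prob (?U n)) \<longlonglongrightarrow> prob (\<Inter>n. ?U n)"
    by (rule finite_Lim_measure_decseq) (auto simp: decseq_def intro: order_trans)
  moreover have "p \<le> prob (?U n)" for n
    using p(2)[of n] finite_measure_mono[of "F n" "?U n"] by force
  ultimately have "p \<le> prob (\<Inter>n. ?U n)"
    by (intro LIMSEQ_le_const) auto
  then have "prob (\<Inter>n. ?U n) = 1"
    using borel_0_1_law[OF F] p by auto
  then have "AE w in M. w \<in> (\<Inter>n. ?U n)"
    by (subst (asm) prob_eq_1) auto
  then show ?thesis by eventually_elim auto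
qed

lemma harmonic_block: "\<exists>N>n. C \<le> (\<Sum>k=n..<N. 1 / real k)"
proof (rule ccontr)
  assume "\<not> ?thesis"
  then have bnd: "\<And>N. n < N \<Longrightarrow> (\<Sum>k=n..<N. 1 / real k) < C" by (auto simp: not_le)
  have "summable (\<lambda>k. 1 / real (k + n))"
  proof (rule summableI_nonneg_bounded[where x="max C 0"])
    fix m
    have "(\<Sum>k<m. 1 / real (k + n)) = (\<Sum>k=n..<m + n. 1 / real k)"
      by (rule sum.reindex_bij_witness[where i="\<lambda>k. k - n" and j="\<lambda>k. k + n"]) auto
    also have "\<dots> \<le> max C 0"
      using bnd[of "m + n"] by (cases "m = 0") auto
    finally show "(\<Sum>k<m. 1 / real (k + n)) \<le> max C 0" .
  qed simp
  then have "summable (\<lambda>k. 1 / real k)" by (subst (asm) summable_iff_shift)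
  then show False using not_summable_harmonic[where 'a=real] by (simp add: inverse_eq_divide)
qed

section \<open>Refinement with random points\<close>

context random_points
begin

text \<open>A tent is used only if \<open>h\<close> exceeds \<open>L * rad n\<close> at its centre,
  while \<open>h\<close> drops by at most that much across it. So \<open>h\<close> is positive on
  the whole closed tent, and the new closed support lies in the positivity set of
  \<open>h\<close>.\<close>

lemma dens_lip_density:
  assumes A: "finite A" "A \<subseteq> {n..}"
    and g0: "\<And>x. 0 \<le> g x"
    and gh: "\<And>x. g x \<noteq> 0 \<Longrightarrow> L * rad n < h x"
    and L: "0 < L" "\<And>x y. \<bar>h x - h y\<bar> \<le> L * \<bar>x - y\<bar>"
    and h: "\<And>x. x \<notin> {0..1} \<Longrightarrow> h x = 0"
    and pos: "mass g A v > 0"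
  defines "h' \<equiv> (\<lambda>x. 1 / mass g A v * dens g A v x)"
  shows "lip_density h'"
    and "closure {x. h' x \<noteq> 0} \<subseteq> {x. h x \<noteq> 0} \<inter> (\<Union>k\<in>{n..}. {v k - 2 * rad k <..< v k + 2 * rad k})"
proof -
  let ?D = "\<Union>k\<in>{k\<in>A. g (v k) \<noteq> 0}. cball (v k) (rad k)"
  \<comment> \<open>Since \<open>A\<close> is finite, the union of closed balls is closed, and
    taking the closure of the support adds nothing outside it.\<close>
  have cl: "closed ?D" using A by (intro closed_UN) auto
  have "{x. h' x \<noteq> 0} \<subseteq> ?D"
  proof
    fix x assume "x \<in> {x. h' x \<noteq> 0}"
    then have "dens g A v x \<noteq> 0" unfolding h'_def by auto
    then obtain k where "k \<in> A" "g (v k) / real k * tent (rad k) (v k) x \<noteq> 0"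
      unfolding dens_def by (meson sum.neutral)
    then have "k \<in> A" "g (v k) \<noteq> 0" "\<bar>x - v k\<bar> < rad k"
      using tent_eq_0[OF rad_pos, of k x "v k"] by force+
    then show "x \<in> ?D" by (auto simp: dist_real_def)
  qed
  then have sub: "closure {x. h' x \<noteq> 0} \<subseteq> ?D" using cl by (rule closure_minimal)
  show cls: "closure {x. h' x \<noteq> 0} \<subseteq> {x. h x \<noteq> 0} \<inter> (\<Union>k\<in>{n..}. {v k - 2 * rad k <..< v k + 2 * rad k})"
  proof
    fix y assume "y \<in> closure {x. h' x \<noteq> 0}"
    then obtain k where k: "k \<in> A" "g (v k) \<noteq> 0" "\<bar>y - v k\<bar> \<le> rad k"
      using sub by (force simp: dist_real_def)
    have "rad k \<le> rad n" using k A by (intro rad_antimono) auto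
    then have "L * \<bar>v k - y\<bar> \<le> L * rad n" using L k by (intro mult_left_mono) auto
    then have "0 < h y" using gh[OF k(2)] L(2)[of "v k" y] by linarith
    moreover have "y \<in> {v k - 2 * rad k <..< v k + 2 * rad k}"
      using k(3) rad_pos[of k] by auto
    ultimately show "y \<in> {x. h x \<noteq> 0} \<inter> (\<Union>k\<in>{n..}. {v k - 2 * rad k <..< v k + 2 * rad k})"
      using k A by auto
  qed
  show "lip_density h'"
    unfolding lip_density_def
  proof (intro conjI allI impI exI)
    show "0 \<le> h' x" for x unfolding h'_def using dens_nonneg[OF g0] pos by simp
    show "h' x = 0" if "x \<notin> {0..1}" for x
    proof (rule ccontr)
      assume "h' x \<noteq> 0"
      then have "x \<in> closure {x. h' x \<noteq> 0}" by (simp add: closure_def)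
      then show False using cls h[OF that] by auto
    qed
    have "(\<integral>\<^sup>+x. ennreal (dens g A v x) \<partial>lborel)
        = (\<integral>\<^sup>+x. (\<Sum>k\<in>A. ennreal (g (v k) / real k) * ennreal (tent (rad k) (v k) x)) \<partial>lborel)"
      unfolding dens_def using g0
      by (intro nn_integral_cong, subst sum_ennreal[symmetric])
         (auto simp: tent_nonneg rad_pos simp del: sum_ennreal simp flip: ennreal_mult)
    also have "\<dots> = (\<Sum>k\<in>A. ennreal (g (v k) / real k) * (\<integral>\<^sup>+x. ennreal (tent (rad k) (v k) x) \<partial>lborel))"
      by (subst nn_integral_sum, measurable, intro sum.cong refl nn_integral_cmult, measurable)
    also have "\<dots> = ennreal (mass g A v)"
      unfolding mass_def using g0 by (simp add: nn_integral_tent rad_pos)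
    finally have I: "(\<integral>\<^sup>+x. ennreal (dens g A v x) \<partial>lborel) = ennreal (mass g A v)" .
    have [measurable]: "dens g A v \<in> borel_measurable borel"
      unfolding dens_def by measurable
    have "(\<integral>\<^sup>+x. ennreal (h' x) \<partial>lborel) = (\<integral>\<^sup>+x. ennreal (1 / mass g A v) * ennreal (dens g A v x) \<partial>lborel)"
      unfolding h'_def using pos dens_nonneg[OF g0] by (intro nn_integral_cong ennreal_mult) auto
    also have "\<dots> = ennreal (1 / mass g A v) * ennreal (mass g A v)"
      by (subst nn_integral_cmult) (auto simp: I)
    also have "\<dots> = 1" using pos by (simp flip: ennreal_mult)
    finally show "(\<integral>\<^sup>+x. ennreal (h' x) \<partial>lborel) = 1" .
  next
    fix x y
    have "\<bar>dens g A v x - dens g A v y\<bar> = \<bar>\<Sum>k\<in>A. g (v k) / real k * (tent (rad k) (v k) x - tent (rad k) (v k) y)\<bar>"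
      unfolding dens_def by (simp add: sum_subtractf right_diff_distrib)
    also have "\<dots> \<le> (\<Sum>k\<in>A. \<bar>g (v k) / real k * (tent (rad k) (v k) x - tent (rad k) (v k) y)\<bar>)"
      by (rule sum_abs)
    also have "\<dots> \<le> (\<Sum>k\<in>A. g (v k) / real k * (1 / (rad k)\<^sup>2 * \<bar>x - y\<bar>))"
      unfolding abs_mult using g0 by (intro sum_mono mult_mono tent_lipschitz rad_pos) auto
    also have "\<dots> = (\<Sum>k\<in>A. g (v k) / real k * (1 / (rad k)\<^sup>2)) * \<bar>x - y\<bar>"
      by (simp add: sum_distrib_right mult.assoc)
    finally have "\<bar>h' x - h' y\<bar> \<le> 1 / mass g A v * ((\<Sum>k\<in>A. g (v k) / real k * (1 / (rad k)\<^sup>2)) * \<bar>x - y\<bar>)"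
      unfolding h'_def right_diff_distrib[symmetric] abs_mult using pos by (intro mult_mono) auto
    then show "\<bar>h' x - h' y\<bar> \<le> (1 / mass g A v * (\<Sum>k\<in>A. g (v k) / real k * (1 / (rad k)\<^sup>2))) * \<bar>x - y\<bar>"
      by (simp only: mult.assoc)
  qed
qed

lemma rad_tendsto_0: "rad \<longlonglongrightarrow> 0"
proof -
  have "(\<lambda>k. exp (- lam * real k) / 4) \<longlonglongrightarrow> 0"
    using lam_pos by real_asymp
  then show ?thesis by (simp add: rad_def[abs_def])
qed

text \<open>The quotient \<open>a / f\<close> would reproduce \<open>a\<close> exactly but may be
  unbounded. Cutting it at level \<open>i\<close> gives a bounded weight, and as \<open>f\<close> is
  positive almost everywhere on \<open>[0,1]\<close>, dominated convergence returns the full mass of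
  \<open>a\<close> in the limit.\<close>

lemma truncated_weight:
  assumes a[measurable]: "a \<in> borel_measurable borel" and a0: "\<And>x. 0 \<le> a x"
    and a1: "\<And>x. x \<notin> {0..1} \<Longrightarrow> a x = 0"
    and fin: "(\<integral>\<^sup>+x. ennreal (a x) \<partial>lborel) < \<infinity>"
    and s: "ennreal s < (\<integral>\<^sup>+x. ennreal (a x) \<partial>lborel)"
  obtains g K where "K > 0" "g \<in> borel_measurable borel" "\<And>x. 0 \<le> g x" "\<And>x. g x \<le> K"
    "\<And>x. f x * ennreal (g x) \<le> ennreal (a x)" "\<And>x. g x \<noteq> 0 \<Longrightarrow> a x \<noteq> 0"
    "ennreal s < (\<integral>\<^sup>+x. f x * ennreal (g x) \<partial>lborel)"
proof -
  define F where "F x = enn2real (f x)" for x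
  have fF: "f x = ennreal (F x)" for x
    unfolding F_def by (rule ennreal_enn2real[symmetric], rule le_less_trans[OF f_bound]) simp
  have F0: "0 \<le> F x" for x by (simp add: F_def)
  have [measurable]: "F \<in> borel_measurable borel" unfolding F_def by measurable
  define g where "g i x = (if F x > 0 then min (real i) (a x / F x) else 0)" for i x
  have gm[measurable]: "g i \<in> borel_measurable borel" for i unfolding g_def by measurable
  have g0: "0 \<le> g i x" for i x using a0[of x] by (auto simp: g_def)
  have ga: "F x * g i x \<le> a x" for i x
  proof (cases "F x > 0")
    case True
    then have "F x * g i x \<le> F x * (a x / F x)" by (intro mult_left_mono) (auto simp: g_def)
    then show ?thesis using True by simp
  qed (auto simp: g_def a0)
  have fg: "f x * ennreal (g i x) = ennreal (F x * g i x)" for i x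
    using F0 g0 by (simp add: fF ennreal_mult)
  have "(\<lambda>i. \<integral>\<^sup>+x. f x * ennreal (g i x) \<partial>lborel) \<longlonglongrightarrow> (\<integral>\<^sup>+x. ennreal (a x) \<partial>lborel)"
  proof (rule nn_integral_dominated_convergence[where w="\<lambda>x. ennreal (a x)"])
    show "AE x in lborel. (\<lambda>i. f x * ennreal (g i x)) \<longlonglongrightarrow> ennreal (a x)"
      using f_pos
    proof eventually_elim
      case (elim x)
      have "\<forall>\<^sub>F i in sequentially. f x * ennreal (g i x) = ennreal (a x)"
      proof (cases "x \<in> {0..1}")
        case True
        then have Fx: "F x > 0" using elim by (simp add: fF)
        have "\<forall>\<^sub>F i in sequentially. a x / F x \<le> real i" by real_asymp
        then show ?thesis
          by eventually_elim (use Fx in \<open>simp add: fg, simp add: g_def\<close>)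
      next
        case False
        then have "g i x = 0" for i using a1[OF False] by (simp add: g_def)
        then show ?thesis using a1[OF False] by simp
      qed
      then show ?case by (rule tendsto_eventually)
    qed
    show "AE x in lborel. f x * ennreal (g i x) \<le> ennreal (a x)" for i
      using ga by (simp add: fg ennreal_leI)
  qed (use fin in auto)
  then have "\<forall>\<^sub>F i in sequentially. ennreal s < (\<integral>\<^sup>+x. f x * ennreal (g i x) \<partial>lborel)"
    using s by (rule order_tendstoD)
  moreover have "\<forall>\<^sub>F i in sequentially. i \<ge> (1::nat)" by (rule eventually_ge_at_top)
  ultimately have "\<forall>\<^sub>F i in sequentially. ennreal s < (\<integral>\<^sup>+x. f x * ennreal (g i x) \<partial>lborel) \<and> i \<ge> 1"
    by eventually_elim auto
  then obtain i where i: "ennreal s < (\<integral>\<^sup>+x. f x * ennreal (g i x) \<partial>lborel)" "i \<ge> 1"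
    using eventually_happens by force
  show thesis
  proof (rule that[of "real i" "g i"])
    show "f x * ennreal (g i x) \<le> ennreal (a x)" for x
      using ga by (simp add: fg ennreal_leI)
    show "g i x \<noteq> 0 \<Longrightarrow> a x \<noteq> 0" for x by (auto simp: g_def min_def split: if_splits)
    show "g i x \<le> real i" for x by (auto simp: g_def)
  qed (use i g0 in auto)
qed

text \<open>The lower bound \<open>p\<close> depends on the weight and the energy gap but not on the
  block, so it serves for infinitely many disjoint blocks at once.\<close>

lemma AE_good_block:
  assumes g[measurable]: "g \<in> borel_measurable borel" and g0: "\<And>x. 0 \<le> g x" and gK: "\<And>x. g x \<le> K" and K: "K > 0"
    and h: "h \<in> borel_measurable borel" and n: "n \<ge> 1"
    and sub: "\<And>k x. k \<ge> n \<Longrightarrow> (\<integral>\<^sup>+t. f t * ennreal (g t * tent (rad k) t x) \<partial>lborel) \<le> ennreal (h x)"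
    and m: "(\<integral>\<^sup>+t. f t * ennreal (g t) \<partial>lborel) = ennreal m" "m \<ge> 0"
    and E: "dens_energy h = ennreal E" "E \<ge> 0" and e: "e > 0" "E < e * m\<^sup>2"
  shows "AE w in M. \<exists>A. finite A \<and> A \<subseteq> {n..} \<and> dens_energy (dens g A (\<lambda>k. c k w)) < ennreal (e * (mass g A (\<lambda>k. c k w))\<^sup>2)"
proof -
  let ?C = "2 + 3 * ln 4 + 3 * lam"
  define Q where "Q A v \<longleftrightarrow> dens_energy (dens g A v) < ennreal (e * (mass g A v)\<^sup>2)" for A v
  \<comment> \<open>Half of the gap \<open>e * m^2 - E\<close>, divided by the factor
    \<open>e * K^2\<close> in front of the probability in the second moment bound.\<close>
  define p where "p = (e * m\<^sup>2 - E) / (2 * e * K\<^sup>2)"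
  have p: "p > 0" using e K by (simp add: p_def)
  have C0: "0 < ?C" using lam_pos by (intro add_pos_pos) auto
  \<comment> \<open>From this harmonic sum on, the diagonal term \<open>K^2 * C * H\<close>, with
    \<open>C\<close> the constant above, uses at most the other half of the gap, because it is
    linear and not quadratic in \<open>H\<close>.\<close>
  define H0 where "H0 = 2 * K\<^sup>2 * ?C / (e * m\<^sup>2 - E)"
  have H0: "H0 > 0" using C0 e K by (simp add: H0_def)
  have block: "p \<le> prob {w\<in>space M. Q A (\<lambda>k. c k w)}"
    if A: "finite A" "A \<subseteq> {n..}" and HA: "H0 \<le> (\<Sum>k\<in>A. 1 / real k)" for A
  proof -
    let ?H = "\<Sum>k\<in>A. 1 / real k"
    have H: "?H > 0" using HA H0 by linarith
    have "e * m\<^sup>2 * ?H\<^sup>2 \<le> E * ?H\<^sup>2 + K\<^sup>2 * ?C * ?H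
       + e * K\<^sup>2 * ?H\<^sup>2 * prob {w\<in>space M. dens_energy (dens g A (\<lambda>k. c k w)) < ennreal (e * (mass g A (\<lambda>k. c k w))\<^sup>2)}"
      by (rule good_block_prob[OF _ _ g g0 gK h sub m E e(1)]) (use A n in auto)
    then have 1: "(e * m\<^sup>2 - E) * ?H\<^sup>2 \<le> K\<^sup>2 * ?C * ?H + e * K\<^sup>2 * prob {w\<in>space M. Q A (\<lambda>k. c k w)} * ?H\<^sup>2"
      unfolding Q_def by (simp add: algebra_simps)
    have "2 * K\<^sup>2 * ?C \<le> ?H * (e * m\<^sup>2 - E)"
      using HA e unfolding H0_def by (subst (asm) pos_divide_le_eq) auto
    then have "K\<^sup>2 * ?C * ?H \<le> (?H * (e * m\<^sup>2 - E) / 2) * ?H"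
      using H by (intro mult_right_mono) auto
    then have "(e * m\<^sup>2 - E) / 2 * ?H\<^sup>2 \<le> e * K\<^sup>2 * prob {w\<in>space M. Q A (\<lambda>k. c k w)} * ?H\<^sup>2"
      using 1 by (simp add: power2_eq_square field_simps)
    then have "(e * m\<^sup>2 - E) / 2 \<le> e * K\<^sup>2 * prob {w\<in>space M. Q A (\<lambda>k. c k w)}"
      using H by simp
    then show ?thesis using e K unfolding p_def by (simp add: divide_simps mult_ac)
  qed
  obtain N where N: "\<And>j. N j > j" "\<And>j. H0 \<le> (\<Sum>k=j..<N j. 1 / real k)"
    using harmonic_block[of _ H0] by metis
  define b where "b i = (N ^^ i) n" for i
  have b0: "b 0 = n" and bS: "b (Suc i) = N (b i)" for i by (simp_all add: b_def)
  have bm: "strict_mono b" by (rule strict_mono_Suc_iff[THEN iffD2]) (simp add: bS N)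
  have bn: "n \<le> b i" for i using strict_mono_less_eq[OF bm, of 0 i] by (simp add: b0)
  define A where "A i = {b i..<b (Suc i)}" for i
  have An: "A i \<subseteq> {n..}" for i using bn[of i] by (auto simp: A_def)
  have "disjoint_family_on A UNIV"
    unfolding disjoint_family_on_def
  proof (intro ballI impI)
    fix i j :: nat assume "i \<noteq> j"
    then have "Suc i \<le> j \<or> Suc j \<le> i" by auto
    then have "b (Suc i) \<le> b j \<or> b (Suc j) \<le> b i" using strict_mono_less_eq[OF bm] by blast
    then show "A i \<inter> A j = {}" by (auto simp: A_def)
  qed
  \<comment> \<open>Disjoint blocks of coordinates are independent as random vectors; the success of
    a block is then pulled back from its own product space.\<close>
  then have "indep_vars (\<lambda>i. PiM (A i) (\<lambda>_. borel)) (\<lambda>i w. restrict (\<lambda>k. c k w) (A i)) UNIV"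
    using An n by (intro indep_vars_restrict[OF indep]) force+
  then have "indep_events (\<lambda>i. {w\<in>space M. Q (A i) (restrict (\<lambda>k. c k w) (A i))}) UNIV"
  proof (rule indep_eventsI_indep_vars)
    fix i
    have [measurable]: "(\<lambda>v. dens_energy (dens g (A i) v)) \<in> borel_measurable (PiM (A i) (\<lambda>_. borel))"
      "(\<lambda>v. mass g (A i) v) \<in> borel_measurable (PiM (A i) (\<lambda>_. borel))"
      by (intro dens_energy_dens_measurable mass_measurable g, measurable)+
    show "{v \<in> space (PiM (A i) (\<lambda>_. borel)). Q (A i) v} \<in> sets (PiM (A i) (\<lambda>_. borel))"
      unfolding Q_def by measurable
  qed
  moreover have "Q (A i) (restrict v (A i)) = Q (A i) v" for i v
  proof -
    have "dens g (A i) (restrict v (A i)) = dens g (A i) v"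
      unfolding dens_def by (intro ext sum.cong) auto
    moreover have "mass g (A i) (restrict v (A i)) = mass g (A i) v"
      unfolding mass_def by (intro sum.cong) auto
    ultimately show ?thesis by (simp add: Q_def)
  qed
  ultimately have ind: "indep_events (\<lambda>i. {w\<in>space M. Q (A i) (\<lambda>k. c k w)}) UNIV" by simp
  have "AE w in M. \<exists>i. w \<in> {w\<in>space M. Q (A i) (\<lambda>k. c k w)}"
    by (rule AE_some_indep_event[OF ind p], rule block) (use An N in \<open>auto simp: A_def bS\<close>)
  then show ?thesis
  proof eventually_elim
    case (elim w)
    then obtain i where "Q (A i) (\<lambda>k. c k w)" by auto
    then show ?case using An[of i] by (intro exI[of _ "A i"]) (auto simp: Q_def A_def)
  qed
qed

text \<open>The gap between \<open>dens_energy h\<close> and \<open>e\<close> pays for two losses: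
  the mass cut off in constructing the weight \<open>g\<close>, and the self-energies of the
  tents.\<close>

lemma AE_refine_density:
  assumes h: "lip_density h" and e: "dens_energy h < ennreal e" and n: "n \<ge> 1"
  shows "AE w in M. \<exists>h'. lip_density h' \<and> dens_energy h' < ennreal e
    \<and> closure {x. h' x \<noteq> 0} \<subseteq> {x. h x \<noteq> 0} \<inter> (\<Union>k\<in>{n..}. {c k w - 2 * rad k <..< c k w + 2 * rad k})"
proof -
  obtain L where L: "L > 0" "\<And>x y. \<bar>h x - h y\<bar> \<le> L * \<bar>x - y\<bar>" using lip_density_obtain[OF h] by blast
  have hm[measurable]: "h \<in> borel_measurable borel" using h by (rule lip_density_measurable)
  have h0: "\<And>x. 0 \<le> h x" and h1: "\<And>x. x \<notin> {0..1} \<Longrightarrow> h x = 0" and hI: "(\<integral>\<^sup>+x. ennreal (h x) \<partial>lborel) = 1"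
    using h by (auto simp: lip_density_def)
  define E where "E = enn2real (dens_energy h)"
  have E: "dens_energy h = ennreal E" "E \<ge> 0" unfolding E_def using e by (auto simp: less_trans[OF _ ennreal_less_top] intro!: ennreal_enn2real[symmetric])
  have Ee: "E < e" using e E by (simp add: ennreal_less_iff)
  have epos: "e > 0" using Ee E by linarith
  define q where "q = E / e"
  have q: "0 \<le> q" "q < 1" using E Ee epos by (auto simp: q_def)
  \<comment> \<open>The mean of \<open>q\<close> and 1 satisfies
    \<open>s^2 - q = ((1 - q) / 2)^2\<close>. So any mean weight \<open>m\<close> above
    \<open>s\<close> still leaves \<open>E < e * m^2\<close>, and a mass of \<open>1 - s\<close> may
    be lost.\<close>
  define s where "s = (1 + q) / 2"
  have s: "0 < s" "s < 1" using q by (auto simp: s_def)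
  have "q < s\<^sup>2"
  proof -
    have "s\<^sup>2 - q = ((1 - q) / 2)\<^sup>2" by (simp add: s_def power2_eq_square field_simps)
    moreover have "\<dots> > 0" using q by simp
    ultimately show ?thesis by linarith
  qed
  then have es: "E < e * s\<^sup>2" using epos by (simp add: q_def field_simps)
  have "(\<lambda>k. L * rad k) \<longlonglongrightarrow> L * 0" by (intro tendsto_intros rad_tendsto_0)
  then have "\<forall>\<^sub>F k in sequentially. L * rad k < 1 - s" using s by (intro order_tendstoD) auto
  then have "\<forall>\<^sub>F k in sequentially. n \<le> k \<and> L * rad k < 1 - s"
    by (intro eventually_conj eventually_ge_at_top)
  then obtain n0 where n0: "n0 \<ge> n" "L * rad n0 < 1 - s"
    using eventually_happens'[OF sequentially_bot] by blast
  \<comment> \<open>Lowering \<open>h\<close> by its oscillation at scale \<open>rad n0\<close>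
    costs less than \<open>1 - s\<close> of mass on the unit interval and ensures
    \<open>a t \<le> h x\<close> whenever \<open>t\<close> and \<open>x\<close> are within
    \<open>rad n0\<close>.\<close>
  define a where "a x = max 0 (h x - L * rad n0)" for x
  have [measurable]: "a \<in> borel_measurable borel" unfolding a_def by measurable
  have Lr: "0 < L * rad n0" using L rad_pos[of n0] by simp
  have a0: "0 \<le> a x" and ah: "a x \<le> h x" for x using h0[of x] Lr by (auto simp: a_def)
  have a1: "x \<notin> {0..1} \<Longrightarrow> a x = 0" for x using h1[of x] Lr by (simp add: a_def)
  have aI: "(\<integral>\<^sup>+x. ennreal (a x) \<partial>lborel) \<le> 1"
    unfolding hI[symmetric] by (intro nn_integral_mono ennreal_leI ah)
  have "1 = (\<integral>\<^sup>+x. ennreal (h x) \<partial>lborel)" by (simp add: hI)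
  also have "\<dots> \<le> (\<integral>\<^sup>+x. ennreal (a x) + ennreal (L * rad n0) * indicator {0..1} x \<partial>lborel)"
  proof (intro nn_integral_mono)
    fix x :: real
    show "ennreal (h x) \<le> ennreal (a x) + ennreal (L * rad n0) * indicator {0..1} x"
    proof (cases "x \<in> {0..1}")
      case True
      have "h x \<le> a x + L * rad n0" by (simp add: a_def)
      then have "ennreal (h x) \<le> ennreal (a x) + ennreal (L * rad n0)"
        using a0 Lr by (simp flip: ennreal_plus add: ennreal_leI)
      then show ?thesis using True by simp
    qed (simp add: h1)
  qed
  also have "\<dots> = (\<integral>\<^sup>+x. ennreal (a x) \<partial>lborel) + ennreal (L * rad n0)"
    by (subst nn_integral_add) (auto simp: nn_integral_cmult_indicator)
  finally have ge1: "1 \<le> (\<integral>\<^sup>+x. ennreal (a x) \<partial>lborel) + ennreal (L * rad n0)" .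
  have sa: "ennreal s < (\<integral>\<^sup>+x. ennreal (a x) \<partial>lborel)"
  proof (rule ccontr)
    assume "\<not> ?thesis"
    then have "1 \<le> ennreal s + ennreal (L * rad n0)"
      using ge1 by (meson add_right_mono not_less order_trans)
    also have "\<dots> = ennreal (s + L * rad n0)" using s Lr by simp
    also have "\<dots> < ennreal 1" using n0 s Lr by (subst ennreal_less_iff) auto
    finally show False by simp
  qed
  obtain g K where K: "K > 0" and g[measurable]: "g \<in> borel_measurable borel"
    and g0: "\<And>x. 0 \<le> g x" and gK: "\<And>x. g x \<le> K"
    and fg: "\<And>x. f x * ennreal (g x) \<le> ennreal (a x)" and ga: "\<And>x. g x \<noteq> 0 \<Longrightarrow> a x \<noteq> 0"
    and gs: "ennreal s < (\<integral>\<^sup>+x. f x * ennreal (g x) \<partial>lborel)"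
    by (rule truncated_weight[of a s]) (use a0 a1 aI sa in \<open>auto simp: le_less_trans less_top[symmetric] top_unique\<close>)
  define m where "m = enn2real (\<integral>\<^sup>+x. f x * ennreal (g x) \<partial>lborel)"
  have "(\<integral>\<^sup>+x. f x * ennreal (g x) \<partial>lborel) \<le> (\<integral>\<^sup>+x. ennreal (a x) \<partial>lborel)"
    by (intro nn_integral_mono fg)
  also note aI
  finally have "(\<integral>\<^sup>+x. f x * ennreal (g x) \<partial>lborel) < top"
    by (rule le_less_trans) simp
  then have m: "(\<integral>\<^sup>+x. f x * ennreal (g x) \<partial>lborel) = ennreal m" "m \<ge> 0"
    by (auto simp: m_def)
  have "s < m" using gs m s by (simp add: ennreal_less_iff)
  then have "s\<^sup>2 \<le> m\<^sup>2" using s by (intro power_mono) auto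
  then have em: "E < e * m\<^sup>2" using es epos by (meson less_le_trans mult_left_mono less_imp_le)
  have sub: "(\<integral>\<^sup>+t. f t * ennreal (g t * tent (rad k) t x) \<partial>lborel) \<le> ennreal (h x)" if k: "k \<ge> n0" for k x
  proof -
    have "(\<integral>\<^sup>+t. f t * ennreal (g t * tent (rad k) t x) \<partial>lborel) \<le> (\<integral>\<^sup>+t. ennreal (h x) * ennreal (tent (rad k) x t) \<partial>lborel)"
    proof (intro nn_integral_mono)
      fix t :: real
      have "f t * ennreal (g t * tent (rad k) t x) = (f t * ennreal (g t)) * ennreal (tent (rad k) t x)"
        using g0 by (simp add: ennreal_mult tent_nonneg rad_pos mult.assoc)
      also have "\<dots> \<le> ennreal (a t) * ennreal (tent (rad k) t x)"
        by (intro mult_right_mono fg) auto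
      also have "\<dots> \<le> ennreal (h x) * ennreal (tent (rad k) x t)"
      proof (cases "\<bar>x - t\<bar> < rad k")
        case True
        have "rad k \<le> rad n0" using k by (rule rad_antimono)
        then have "L * \<bar>t - x\<bar> \<le> L * rad n0" using True L by (intro mult_left_mono) auto
        then have "a t \<le> h x" using L(2)[of t x] h0[of x] by (auto simp: a_def)
        then show ?thesis by (subst tent_sym) (intro mult_right_mono ennreal_leI, auto)
      next
        case False
        then show ?thesis by (simp add: tent_eq_0[OF rad_pos])
      qed
      finally show "f t * ennreal (g t * tent (rad k) t x) \<le> ennreal (h x) * ennreal (tent (rad k) x t)" .
    qed
    also have "\<dots> = ennreal (h x)"
      by (subst nn_integral_cmult) (auto simp: nn_integral_tent rad_pos)
    finally show ?thesis .
  qed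
  have "AE w in M. \<exists>A. finite A \<and> A \<subseteq> {n0..} \<and> dens_energy (dens g A (\<lambda>k. c k w)) < ennreal (e * (mass g A (\<lambda>k. c k w))\<^sup>2)"
    by (rule AE_good_block[OF g g0 gK K hm _ sub m E epos em]) (use n n0 in auto)
  then show ?thesis
  proof eventually_elim
    case (elim w)
    then obtain A where A: "finite A" "A \<subseteq> {n0..}"
      and lt: "dens_energy (dens g A (\<lambda>k. c k w)) < ennreal (e * (mass g A (\<lambda>k. c k w))\<^sup>2)" by blast
    let ?Z = "mass g A (\<lambda>k. c k w)"
    let ?h = "\<lambda>x. 1 / ?Z * dens g A (\<lambda>k. c k w) x"
    \<comment> \<open>With zero mass the strict bound \<open>lt\<close> would read
      \<open>< 0\<close>; so a good block can always be normalised.\<close>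
    have Z: "?Z > 0"
    proof (rule ccontr)
      assume "\<not> ?Z > 0"
      then have "?Z = 0" using mass_nonneg[of g A "\<lambda>k. c k w"] g0 by force
      then show False using lt by simp
    qed
    have gh: "L * rad n0 < h x" if "g x \<noteq> 0" for x using ga[OF that] by (auto simp: a_def max_def split: if_splits)
    note D = dens_lip_density[OF A g0 gh L h1 Z]
    have [measurable]: "dens g A (\<lambda>k. c k w) \<in> borel_measurable borel"
      unfolding dens_def by measurable
    have "dens_energy ?h = ennreal ((1 / ?Z)\<^sup>2) * dens_energy (dens g A (\<lambda>k. c k w))"
      using Z by (intro dens_energy_cmult dens_nonneg g0) auto
    also have "\<dots> < ennreal ((1 / ?Z)\<^sup>2) * ennreal (e * ?Z\<^sup>2)"
      using lt Z by (intro ennreal_mult_strict_left_mono) auto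
    also have "\<dots> = ennreal e"
      using Z epos by (simp add: power_divide flip: ennreal_mult)
    finally have "dens_energy ?h < ennreal e" .
    moreover have "(\<Union>k\<in>{n0..}. {c k w - 2 * rad k <..< c k w + 2 * rad k}) \<subseteq> (\<Union>k\<in>{n..}. {c k w - 2 * rad k <..< c k w + 2 * rad k})"
      using n0 by (intro UN_mono) auto
    ultimately show ?case using D by (intro exI[of _ ?h]) blast
  qed
qed

end

section \<open>Refining all densities simultaneously\<close>

text \<open>In the iteration the density to be refined depends on the sample point, so the null set must not
  depend on it. Every Lipschitz density is nearly attained from below by a maximum of finitely many
  rational tents, and there are only countably many of these.\<close>

fun tent_max :: "(rat \<times> rat \<times> rat) list \<Rightarrow> real \<Rightarrow> real" where
  "tent_max [] x = 0"
| "tent_max ((a, b, p) # l) x = max (max 0 (of_rat a - of_rat b * \<bar>x - of_rat p\<bar>)) (tent_max l x)"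

text \<open>If the integral is zero or infinite, the factor is \<open>1 / 0 = 0\<close> and the
  result is the zero function. It fails \<open>lip_density\<close>, so such lists drop out without
  special treatment.\<close>

definition norm_tent_max :: "(rat \<times> rat \<times> rat) list \<Rightarrow> real \<Rightarrow> real" where
  "norm_tent_max l x = 1 / enn2real (\<integral>\<^sup>+x. ennreal (tent_max l x) \<partial>lborel) * tent_max l x"

lemma tent_max_nonneg: "0 \<le> tent_max l x"
  by (induction l x rule: tent_max.induct) auto

lemma tent_max_ge: "(a, b, p) \<in> set l \<Longrightarrow> of_rat a - of_rat b * \<bar>x - of_rat p\<bar> \<le> tent_max l x"
  by (induction l x rule: tent_max.induct) (auto simp: le_max_iff_disj)

lemma tent_max_le:
  assumes "\<And>a b p. (a, b, p) \<in> set l \<Longrightarrow> of_rat a - of_rat b * \<bar>x - of_rat p\<bar> \<le> y" "0 \<le> y"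
  shows "tent_max l x \<le> y"
  using assms by (induction l x rule: tent_max.induct) auto

lemma tent_max_lipschitz: "\<exists>L. \<forall>x y. \<bar>tent_max l x - tent_max l y\<bar> \<le> L * \<bar>x - y\<bar>"
proof (induction l)
  case Nil
  show ?case by (intro exI[of _ 0]) simp
next
  case (Cons t l)
  obtain a b p where t: "t = (a, b, p)" by (cases t)
  obtain L where L: "\<And>x y. \<bar>tent_max l x - tent_max l y\<bar> \<le> L * \<bar>x - y\<bar>" using Cons by blast
  let ?a = "real_of_rat a" and ?b = "real_of_rat b" and ?p = "real_of_rat p"
  have "\<bar>tent_max (t # l) x - tent_max (t # l) y\<bar> \<le> max \<bar>?b\<bar> L * \<bar>x - y\<bar>" for x y
  proof -
    have "\<bar>?b * \<bar>x - ?p\<bar> - ?b * \<bar>y - ?p\<bar>\<bar> = \<bar>?b\<bar> * \<bar>\<bar>x - ?p\<bar> - \<bar>y - ?p\<bar>\<bar>"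
      by (simp add: abs_mult flip: right_diff_distrib)
    also have "\<dots> \<le> \<bar>?b\<bar> * \<bar>x - y\<bar>" by (intro mult_left_mono) auto
    also have "\<dots> \<le> max \<bar>?b\<bar> L * \<bar>x - y\<bar>" by (intro mult_right_mono) auto
    finally have 1: "\<bar>?b * \<bar>x - ?p\<bar> - ?b * \<bar>y - ?p\<bar>\<bar> \<le> max \<bar>?b\<bar> L * \<bar>x - y\<bar>" .
    have "L * \<bar>x - y\<bar> \<le> max \<bar>?b\<bar> L * \<bar>x - y\<bar>" by (intro mult_right_mono) auto
    then have 2: "\<bar>tent_max l x - tent_max l y\<bar> \<le> max \<bar>?b\<bar> L * \<bar>x - y\<bar>"
      using L[of x y] by linarith
    have "\<bar>max u v - max u' v'\<bar> \<le> C" if "\<bar>u - u'\<bar> \<le> C" "\<bar>v - v'\<bar> \<le> C" for u v u' v' C :: real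
      using that by auto
    note m = this
    show ?thesis unfolding t tent_max.simps
      by (intro m 2; use 1 in linarith)
  qed
  then show ?case by blast
qed

lemma tent_max_measurable [measurable]: "tent_max l \<in> borel_measurable borel"
  using tent_max_lipschitz[of l] lipschitz_real_measurable by blast

text \<open>A Lipschitz function lies above each cone hung below its graph with slope at least
  \<open>L\<close>. The maximum of such cones over a fine grid, with apexes lowered slightly to
  rational heights, is a minorant close to \<open>h\<close>.\<close>

lemma tent_max_approx:
  assumes h: "lip_density h" and d: "d > 0"
  obtains l where "\<And>x. tent_max l x \<le> h x" "\<And>x. x \<in> {0..1} \<Longrightarrow> h x - d \<le> tent_max l x"
proof -
  obtain L where L: "L > 0" "\<And>x y. \<bar>h x - h y\<bar> \<le> L * \<bar>x - y\<bar>" using lip_density_obtain[OF h] by blast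
  define b where "b = nat \<lceil>L\<rceil>"
  have b: "L \<le> real b" unfolding b_def by linarith
  \<comment> \<open>Mesh \<open>1 / N\<close> with \<open>b / N \<le> d / 4\<close>: rounding the
    height costs \<open>d / 2\<close>, and the descent of the cone and the variation of
    \<open>h\<close> cost \<open>d / 4\<close> each. The \<open>+ 1\<close> keeps \<open>N\<close>
    positive.\<close>
  define N where "N = nat \<lceil>4 * real b / d\<rceil> + 1"
  have N: "4 * real b / d \<le> real N" "N > 0" unfolding N_def by linarith+
  have "\<exists>a. h (real i / real N) - d / 2 < real_of_rat a \<and> real_of_rat a < h (real i / real N)" for i
    using of_rat_dense[of "h (real i / real N) - d / 2" "h (real i / real N)"] d by auto
  then obtain a where a: "\<And>i. h (real i / real N) - d / 2 < real_of_rat (a i)"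
      "\<And>i. real_of_rat (a i) < h (real i / real N)" by metis
  define l where "l = map (\<lambda>i. (a i, of_nat b :: rat, of_nat i / of_nat N :: rat)) [0..<Suc N]"
  show thesis
  proof (rule that[of l])
    fix x
    show "tent_max l x \<le> h x"
    proof (rule tent_max_le)
      fix a' b' p assume "(a', b', p) \<in> set l"
      then obtain i where i: "a' = a i" "b' = of_nat b" "p = of_nat i / of_nat N" by (auto simp: l_def)
      have "L * \<bar>x - real i / real N\<bar> \<le> real b * \<bar>x - real i / real N\<bar>"
        using b by (intro mult_right_mono) auto
      then show "real_of_rat a' - real_of_rat b' * \<bar>x - real_of_rat p\<bar> \<le> h x"
        using a(2)[of i] L(2)[of x "real i / real N"] by (simp add: i of_rat_divide)
    qed (use h in \<open>simp add: lip_density_def\<close>)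
  next
    fix x :: real assume x: "x \<in> {0..1}"
    define i where "i = nat \<lfloor>x * real N\<rfloor>"
    have i1: "real i \<le> x * real N" "x * real N < real i + 1"
      using x unfolding i_def by auto
    have "x * real N \<le> 1 * real N" using x by (intro mult_right_mono) auto
    then have "i \<le> N" using i1 by linarith
    then have "(a i, of_nat b, of_nat i / of_nat N) \<in> set l"
      unfolding l_def set_map set_upt by (intro image_eqI[of _ _ i]) auto
    then have "real_of_rat (a i) - real_of_rat (of_nat b) * \<bar>x - real_of_rat (of_nat i / of_nat N)\<bar> \<le> tent_max l x"
      by (rule tent_max_ge)
    then have 1: "real_of_rat (a i) - real b * \<bar>x - real i / real N\<bar> \<le> tent_max l x"
      by (simp add: of_rat_divide)
    have "x - real i / real N = (x * real N - real i) / real N" using N by (simp add: field_simps)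
    also have "\<bar>\<dots>\<bar> \<le> 1 / real N"
      unfolding abs_divide abs_of_nat using i1 by (intro divide_right_mono) auto
    finally have "\<bar>x - real i / real N\<bar> \<le> 1 / real N" .
    then have 2: "real b * \<bar>x - real i / real N\<bar> \<le> real b * (1 / real N)" by (intro mult_left_mono) auto
    have "L * \<bar>x - real i / real N\<bar> \<le> real b * \<bar>x - real i / real N\<bar>"
      using b by (intro mult_right_mono) auto
    moreover have "real b * (1 / real N) \<le> d / 4"
      using N d by (simp add: field_simps)
    ultimately show "h x - d \<le> tent_max l x"
      using 1 2 a(1)[of i] L(2)[of x "real i / real N"] by linarith
  qed
qed

text \<open>A minorant has smaller energy and smaller positivity set. Normalising it raises the
  energy by at most the factor \<open>(1 / (1 - d))^2\<close>, which the strict inequality absorbs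
  for small \<open>d\<close>. The rational \<open>q\<close> makes the levels countable as
  well.\<close>

lemma tent_max_approx_density:
  assumes h: "lip_density h" and e: "dens_energy h < ennreal e"
  obtains l q where "lip_density (norm_tent_max l)" "dens_energy (norm_tent_max l) < ennreal (real_of_rat q)"
    "real_of_rat q \<le> e" "\<And>x. norm_tent_max l x \<noteq> 0 \<Longrightarrow> h x \<noteq> 0"
proof -
  have hm[measurable]: "h \<in> borel_measurable borel" using h by (rule lip_density_measurable)
  have h0: "\<And>x. 0 \<le> h x" and h1: "\<And>x. x \<notin> {0..1} \<Longrightarrow> h x = 0" and hI: "(\<integral>\<^sup>+x. ennreal (h x) \<partial>lborel) = 1"
    using h by (auto simp: lip_density_def)
  define E where "E = enn2real (dens_energy h)"
  have E: "dens_energy h = ennreal E" "E \<ge> 0" unfolding E_def using e by (auto simp: less_trans[OF _ ennreal_less_top] intro!: ennreal_enn2real[symmetric])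
  have Ee: "E < e" using e E by (simp add: ennreal_less_iff)
  have "((\<lambda>d. (1 / (1 - d))\<^sup>2 * E) \<longlongrightarrow> (1 / (1 - 0))\<^sup>2 * E) (at_right 0)"
    by (intro tendsto_intros) auto
  then have "\<forall>\<^sub>F d in at_right 0. (1 / (1 - d))\<^sup>2 * E < e"
    using Ee by (intro order_tendstoD) auto
  moreover have "\<forall>\<^sub>F d in at_right (0::real). 0 < d \<and> d < 1"
    unfolding eventually_at_right_field by (intro exI[of _ 1]) auto
  ultimately have "\<forall>\<^sub>F d in at_right 0. (1 / (1 - d))\<^sup>2 * E < e \<and> 0 < d \<and> d < 1"
    by eventually_elim auto
  then obtain d where d: "(1 / (1 - d))\<^sup>2 * E < e" "0 < d" "d < 1"
    using eventually_happens'[OF trivial_limit_at_right_real] by blast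
  obtain l where l: "\<And>x. tent_max l x \<le> h x" "\<And>x. x \<in> {0..1} \<Longrightarrow> h x - d \<le> tent_max l x"
    using tent_max_approx[OF h d(2)] by blast
  define I where "I = enn2real (\<integral>\<^sup>+x. ennreal (tent_max l x) \<partial>lborel)"
  have le1: "(\<integral>\<^sup>+x. ennreal (tent_max l x) \<partial>lborel) \<le> 1"
    unfolding hI[symmetric] by (intro nn_integral_mono ennreal_leI l)
  then have I: "(\<integral>\<^sup>+x. ennreal (tent_max l x) \<partial>lborel) = ennreal I"
    unfolding I_def by (intro ennreal_enn2real[symmetric] le_less_trans[OF le1]) auto
  have "1 = (\<integral>\<^sup>+x. ennreal (h x) \<partial>lborel)" by (simp add: hI)
  also have "\<dots> \<le> (\<integral>\<^sup>+x. ennreal (tent_max l x) + ennreal d * indicator {0..1} x \<partial>lborel)"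
  proof (intro nn_integral_mono)
    fix x :: real
    show "ennreal (h x) \<le> ennreal (tent_max l x) + ennreal d * indicator {0..1} x"
    proof (cases "x \<in> {0..1}")
      case True
      then have "h x \<le> tent_max l x + d" using l(2)[of x] by simp
      then have "ennreal (h x) \<le> ennreal (tent_max l x) + ennreal d"
        using tent_max_nonneg d by (simp flip: ennreal_plus add: ennreal_leI)
      then show ?thesis using True by simp
    qed (simp add: h1)
  qed
  also have "\<dots> = ennreal I + ennreal d"
    by (subst nn_integral_add) (auto simp: nn_integral_cmult_indicator I)
  also have "\<dots> = ennreal (I + d)" using d by (simp add: I_def)
  finally have "ennreal 1 \<le> ennreal (I + d)" by simp
  moreover have "0 \<le> I + d" using d by (simp add: I_def)
  ultimately have Id: "1 - d \<le> I" by (subst (asm) ennreal_le_iff) auto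
  then have Ipos: "I > 0" using d by linarith
  have N: "norm_tent_max l = (\<lambda>x. 1 / I * tent_max l x)"
    unfolding norm_tent_max_def I_def by simp
  have "lip_density (norm_tent_max l)"
    unfolding lip_density_def N
  proof (intro conjI allI impI)
    obtain L where L: "\<And>x y. \<bar>tent_max l x - tent_max l y\<bar> \<le> L * \<bar>x - y\<bar>" using tent_max_lipschitz by blast
    have "\<bar>1 / I * tent_max l x - 1 / I * tent_max l y\<bar> \<le> (1 / I * L) * \<bar>x - y\<bar>" for x y
    proof -
      have "\<bar>1 / I * tent_max l x - 1 / I * tent_max l y\<bar> = 1 / I * \<bar>tent_max l x - tent_max l y\<bar>"
        unfolding right_diff_distrib[symmetric] abs_mult using Ipos by simp
      also have "\<dots> \<le> 1 / I * (L * \<bar>x - y\<bar>)" using Ipos L by (intro mult_left_mono) auto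
      finally show ?thesis by (simp only: mult.assoc)
    qed
    then show "\<exists>L. \<forall>x y. \<bar>1 / I * tent_max l x - 1 / I * tent_max l y\<bar> \<le> L * \<bar>x - y\<bar>" by blast
    show "0 \<le> 1 / I * tent_max l x" for x using Ipos tent_max_nonneg by simp
    show "1 / I * tent_max l x = 0" if "x \<notin> {0..1}" for x
      using l(1)[of x] tent_max_nonneg[of l x] h1[OF that] by simp
    have "(\<integral>\<^sup>+x. ennreal (1 / I * tent_max l x) \<partial>lborel) = (\<integral>\<^sup>+x. ennreal (1 / I) * ennreal (tent_max l x) \<partial>lborel)"
      using Ipos tent_max_nonneg by (intro nn_integral_cong ennreal_mult) auto
    also have "\<dots> = 1" by (subst nn_integral_cmult) (use Ipos in \<open>auto simp: I simp flip: ennreal_mult\<close>)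
    finally show "(\<integral>\<^sup>+x. ennreal (1 / I * tent_max l x) \<partial>lborel) = 1" .
  qed
  moreover have "dens_energy (norm_tent_max l) < ennreal e"
  proof -
    have "dens_energy (norm_tent_max l) = ennreal ((1 / I)\<^sup>2) * dens_energy (tent_max l)"
      unfolding N using Ipos by (intro dens_energy_cmult tent_max_nonneg) auto
    also have "\<dots> \<le> ennreal ((1 / (1 - d))\<^sup>2) * dens_energy h"
      using Id Ipos d by (intro mult_mono dens_energy_mono l ennreal_leI power_mono divide_left_mono) auto
    also have "\<dots> = ennreal ((1 / (1 - d))\<^sup>2 * E)" using E by (simp add: ennreal_mult)
    also have "\<dots> < ennreal e" using d E by (intro ennreal_lessI) (auto intro: le_less_trans[OF _ d(1)])
    finally show ?thesis .
  qed
  moreover obtain q where "dens_energy (norm_tent_max l) < ennreal (real_of_rat q)" "real_of_rat q \<le> e"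
  proof -
    define E' where "E' = enn2real (dens_energy (norm_tent_max l))"
    have E': "dens_energy (norm_tent_max l) = ennreal E'" "E' \<ge> 0"
      unfolding E'_def using \<open>dens_energy (norm_tent_max l) < ennreal e\<close>
      by (auto simp: less_trans[OF _ ennreal_less_top] intro!: ennreal_enn2real[symmetric])
    then have "E' < e" using \<open>dens_energy (norm_tent_max l) < ennreal e\<close> by (simp add: ennreal_less_iff)
    then obtain q where "E' < real_of_rat q" "real_of_rat q < e" using of_rat_dense by blast
    then show thesis using that[of q] E' by (auto simp: ennreal_less_iff)
  qed
  moreover have "h x \<noteq> 0" if "norm_tent_max l x \<noteq> 0" for x
    using that l(1)[of x] tent_max_nonneg[of l x] unfolding N by auto
  ultimately show thesis using that by blast
qed

text \<open>A refinement of the approximant below the level \<open>q\<close> also refines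
  \<open>h\<close> below \<open>e\<close>, as the positivity set of the approximant lies in that of
  \<open>h\<close> and \<open>q\<close> is at most \<open>e\<close>. Hence one null set for each
  list, rational level and \<open>n\<close> is enough.\<close>

lemma (in random_points) AE_refine_all:
  "AE w in M. \<forall>h e n. lip_density h \<longrightarrow> dens_energy h < ennreal e \<longrightarrow> n \<ge> 1 \<longrightarrow>
    (\<exists>h'. lip_density h' \<and> dens_energy h' < ennreal e
      \<and> closure {x. h' x \<noteq> 0} \<subseteq> {x. h x \<noteq> 0} \<inter> (\<Union>k\<in>{n..}. {c k w - 2 * rad k <..< c k w + 2 * rad k}))"
proof -
  let ?R = "\<lambda>w h e n. \<exists>h'. lip_density h' \<and> dens_energy h' < ennreal e
      \<and> closure {x. h' x \<noteq> 0} \<subseteq> {x. h x \<noteq> 0} \<inter> (\<Union>k\<in>{n..}. {c k w - 2 * rad k <..< c k w + 2 * rad k})"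
  have "AE w in M. \<forall>l q n. lip_density (norm_tent_max l) \<longrightarrow> dens_energy (norm_tent_max l) < ennreal (real_of_rat q) \<longrightarrow> n \<ge> 1
      \<longrightarrow> ?R w (norm_tent_max l) (real_of_rat q) n"
    unfolding AE_all_countable
  proof (intro allI)
    fix l q and n :: nat
    show "AE w in M. lip_density (norm_tent_max l) \<longrightarrow> dens_energy (norm_tent_max l) < ennreal (real_of_rat q) \<longrightarrow> n \<ge> 1
      \<longrightarrow> ?R w (norm_tent_max l) (real_of_rat q) n"
    proof (cases "lip_density (norm_tent_max l) \<and> dens_energy (norm_tent_max l) < ennreal (real_of_rat q) \<and> n \<ge> 1")
      case True
      then have "AE w in M. ?R w (norm_tent_max l) (real_of_rat q) n"
        by (intro AE_refine_density) auto
      then show ?thesis by eventually_elim blast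
    next
      case False
      then show ?thesis by (intro AE_I2) blast
    qed
  qed
  then show ?thesis
  proof eventually_elim
    case (elim w)
    show ?case
    proof (intro allI impI)
      fix h e and n :: nat assume h: "lip_density h" "dens_energy h < ennreal e" and n: "n \<ge> 1"
      obtain l q where l: "lip_density (norm_tent_max l)" "dens_energy (norm_tent_max l) < ennreal (real_of_rat q)"
        "real_of_rat q \<le> e" "\<And>x. norm_tent_max l x \<noteq> 0 \<Longrightarrow> h x \<noteq> 0"
        using tent_max_approx_density[OF h] by blast
      from elim[rule_format, OF l(1,2) n]
      obtain h' where h': "lip_density h'" "dens_energy h' < ennreal (real_of_rat q)"
        "closure {x. h' x \<noteq> 0} \<subseteq> {x. norm_tent_max l x \<noteq> 0} \<inter> (\<Union>k\<in>{n..}. {c k w - 2 * rad k <..< c k w + 2 * rad k})"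
        by (elim exE conjE)
      have "dens_energy h' < ennreal e" using h'(2) l(3) by (meson ennreal_leI less_le_trans)
      moreover have "{x. norm_tent_max l x \<noteq> 0} \<subseteq> {x. h x \<noteq> 0}" using l(4) by auto
      note order_trans[OF h'(3) Int_mono[OF this order_refl]]
      ultimately show "?R w h e n" using h'(1) by (intro exI[of _ h'] conjI)
    qed
  qed
qed

section \<open>Limits of nested densities\<close>

lemma real_kernel_lsc:
  assumes "x \<longlonglongrightarrow> a" "y \<longlonglongrightarrow> b"
  shows "real_kernel (a, b) \<le> liminf (\<lambda>n. real_kernel (x n, y n))"
proof -
  have d: "(\<lambda>n. \<bar>x n - y n\<bar>) \<longlonglongrightarrow> \<bar>a - b\<bar>" by (intro tendsto_intros assms)
  show ?thesis
  proof (cases "a = b")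
    case True
    \<comment> \<open>At a diagonal point the kernel is infinite, so the liminf must exceed every
      bound: within distance \<open>exp (- B)\<close> the kernel is at least
      \<open>B\<close>.\<close>
    have ge: "ennreal B \<le> liminf (\<lambda>n. real_kernel (x n, y n))" for B
    proof (rule Liminf_bounded)
      have "\<forall>\<^sub>F n in sequentially. \<bar>x n - y n\<bar> < exp (- B)"
        using d True by (intro order_tendstoD) auto
      then show "\<forall>\<^sub>F n in sequentially. ennreal B \<le> real_kernel (x n, y n)"
      proof eventually_elim
        case (elim n)
        show ?case
        proof (cases "x n = y n")
          case False
          then have "ln \<bar>x n - y n\<bar> < ln (exp (- B))" using elim by (subst ln_less_cancel_iff) auto
          then show ?thesis using False by (auto simp: real_kernel_alt intro!: ennreal_leI)
        qed (simp add: real_kernel_alt)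
      qed
    qed
    have "liminf (\<lambda>n. real_kernel (x n, y n)) = top"
    proof (rule ccontr)
      assume "liminf (\<lambda>n. real_kernel (x n, y n)) \<noteq> top"
      then obtain t where "0 \<le> t" "liminf (\<lambda>n. real_kernel (x n, y n)) = ennreal t"
        by (cases "liminf (\<lambda>n. real_kernel (x n, y n))") auto
      then show False using ge[of "t + 1"] by (simp del: ennreal_plus)
    qed
    then show ?thesis by simp
  next
    case False
    have "(\<lambda>n. ennreal (max 0 (- ln \<bar>x n - y n\<bar>))) \<longlonglongrightarrow> ennreal (max 0 (- ln \<bar>a - b\<bar>))"
      using False by (intro tendsto_ennrealI tendsto_intros d) auto
    moreover have "\<forall>\<^sub>F n in sequentially. ennreal (max 0 (- ln \<bar>x n - y n\<bar>)) = real_kernel (x n, y n)"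
    proof -
      have "\<forall>\<^sub>F n in sequentially. 0 < \<bar>x n - y n\<bar>" using d False by (intro order_tendstoD) auto
      then show ?thesis by eventually_elim (auto simp: real_kernel_alt)
    qed
    ultimately have "(\<lambda>n. real_kernel (x n, y n)) \<longlonglongrightarrow> real_kernel (a, b)"
      using False by (subst (asm) tendsto_cong) (auto simp: real_kernel_alt)
    then have "liminf (\<lambda>n. real_kernel (x n, y n)) = real_kernel (a, b)"
      by (intro lim_imp_Liminf) auto
    then show ?thesis by simp
  qed
qed

definition lebesgue_density :: "(real \<Rightarrow> real) \<Rightarrow> real measure" where
  "lebesgue_density h = density lborel (\<lambda>x. ennreal (h x))"

lemma real_distribution_lebesgue_density: "lip_density h \<Longrightarrow> real_distribution (lebesgue_density h)"
proof -
  assume h: "lip_density h"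
  have [measurable]: "h \<in> borel_measurable borel" using h by (rule lip_density_measurable)
  have "prob_space (lebesgue_density h)"
    by (rule prob_spaceI) (use h in \<open>simp add: lebesgue_density_def emeasure_density lip_density_def\<close>)
  then interpret prob_space "lebesgue_density h" .
  show ?thesis by standard (simp_all add: lebesgue_density_def)
qed

lemma energy_lebesgue_density:
  assumes h: "lip_density h"
  shows "(\<integral>\<^sup>+p. real_kernel p \<partial>(lebesgue_density h \<Otimes>\<^sub>M lebesgue_density h)) = dens_energy h"
proof -
  have [measurable]: "h \<in> borel_measurable borel" using h by (rule lip_density_measurable)
  interpret real_distribution "lebesgue_density h" using h by (rule real_distribution_lebesgue_density)
  have s: "sigma_finite_measure (density lborel (\<lambda>x. ennreal (h x)))"
    using sigma_finite_measure_axioms by (simp add: lebesgue_density_def)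
  have "lebesgue_density h \<Otimes>\<^sub>M lebesgue_density h = density (lborel \<Otimes>\<^sub>M lborel) (\<lambda>(x, y). ennreal (h x) * ennreal (h y))"
    unfolding lebesgue_density_def by (rule pair_measure_density) (auto intro: s lborel.sigma_finite_measure_axioms)
  then show ?thesis
    unfolding dens_energy_def by (simp add: nn_integral_density case_prod_beta')
qed

lemma AE_lebesgue_density: "lip_density h \<Longrightarrow> AE x in lebesgue_density h. h x \<noteq> 0"
  unfolding lebesgue_density_def using lip_density_measurable[of h] by (subst AE_density) auto

text \<open>Skorohod's representation turns weak convergence into pointwise convergence, so that Fatou's lemma
  yields lower semicontinuity of the energy.\<close>

lemma limit_measure:
  assumes h: "\<And>n. lip_density (h n)" and e: "\<And>n. dens_energy (h n) \<le> e"
    and sub: "\<And>n. closure {x. h (Suc n) x \<noteq> 0} \<subseteq> {x. h n x \<noteq> 0}"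
  obtains \<mu> where "real_distribution \<mu>" "AE x in \<mu>. \<forall>n. x \<in> closure {x. h n x \<noteq> 0}"
    "(\<integral>\<^sup>+p. real_kernel p \<partial>(\<mu> \<Otimes>\<^sub>M \<mu>)) \<le> e"
proof -
  let ?S = "\<lambda>n. {x. h n x \<noteq> 0}"
  have S01: "?S n \<subseteq> {0..1}" for n using h[of n] by (auto simp: lip_density_def)
  have dec: "decseq (\<lambda>n. closure (?S n))"
    by (rule decseq_SucI) (use sub closure_subset in blast)
  have "tight (\<lambda>n. lebesgue_density (h n))"
    unfolding tight_def
  proof (intro conjI allI impI)
    show rd: "real_distribution (lebesgue_density (h n))" for n using h by (rule real_distribution_lebesgue_density)
    fix \<epsilon> :: real assume eps: "\<epsilon> > 0"
    \<comment> \<open>Tightness is expressed with half-open intervals; starting at -1 keeps the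
      point 0 inside.\<close>
    have "measure (lebesgue_density (h n)) {-1<..1} = 1" for n
    proof -
      interpret real_distribution "lebesgue_density (h n)" by (rule rd)
      have "AE x in lebesgue_density (h n). x \<in> {-1<..1}"
        using AE_lebesgue_density[OF h[of n]] by eventually_elim (use S01[of n] in force)
      then show ?thesis by (subst prob_eq_1) auto
    qed
    then show "\<exists>a b. a < b \<and> (\<forall>n. 1 - \<epsilon> < measure (lebesgue_density (h n)) {a<..b})"
      using eps by (intro exI[of _ "-1"] exI[of _ 1]) auto
  qed
  from tight_imp_convergent_subsubsequence[OF this strict_mono_id]
  obtain r \<mu> where r: "strict_mono (r :: nat \<Rightarrow> nat)" and \<mu>: "real_distribution \<mu>"
    and conv: "weak_conv_m (\<lambda>n. lebesgue_density (h (r n))) \<mu>" by (auto simp: o_def id_def)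
  obtain \<Omega> :: "real measure" and Yn :: "nat \<Rightarrow> real \<Rightarrow> real" and Y :: "real \<Rightarrow> real" where
    \<Omega>: "prob_space \<Omega>" and Yn[measurable]: "\<And>n. Yn n \<in> borel_measurable \<Omega>"
    and dYn: "\<And>n. distr \<Omega> borel (Yn n) = lebesgue_density (h (r n))"
    and Y[measurable]: "Y \<in> borel_measurable \<Omega>" and dY: "distr \<Omega> borel Y = \<mu>"
    and lim: "\<And>x. x \<in> space \<Omega> \<Longrightarrow> (\<lambda>n. Yn n x) \<longlonglongrightarrow> Y x"
    using Skorohod[OF real_distribution_lebesgue_density[OF h] \<mu> conv] by force
  interpret \<Omega>: prob_space \<Omega> by (rule \<Omega>)
  have "AE x in \<Omega>. \<forall>n. Yn n x \<in> ?S (r n)"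
    unfolding AE_all_countable
  proof
    fix n
    have "AE x in distr \<Omega> borel (Yn n). h (r n) x \<noteq> 0" unfolding dYn using h by (rule AE_lebesgue_density)
    then show "AE x in \<Omega>. Yn n x \<in> ?S (r n)"
      using lip_density_measurable[OF h, of "r n"] by (subst (asm) AE_distr_iff) auto
  qed
  \<comment> \<open>For every \<open>n\<close>, all but finitely many \<open>Yn j x\<close> lie in
    the \<open>n\<close>-th closed support because the supports are nested, so their limit lies in
    it too.\<close>
  then have "AE x in \<Omega>. Y x \<in> (\<Inter>n. closure (?S n))"
    using AE_space
  proof eventually_elim
    case (elim x)
    show ?case
    proof
      fix n
      have "\<forall>\<^sub>F j in sequentially. Yn j x \<in> closure (?S n)"
      proof (rule eventually_sequentiallyI[of n])
        fix j assume "n \<le> j"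
        then have "n \<le> r j" using seq_suble[OF r, of j] by linarith
        then have "closure (?S (r j)) \<subseteq> closure (?S n)" using dec by (auto simp: decseq_def)
        then show "Yn j x \<in> closure (?S n)" using elim closure_subset by blast
      qed
      then show "Y x \<in> closure (?S n)"
        by (rule Lim_in_closed_set[OF closed_closure _ sequentially_bot lim[OF elim(2)]])
    qed
  qed
  moreover have [measurable]: "(\<Inter>n. closure (?S n)) \<in> sets borel"
    by (intro borel_closed closed_INT) auto
  ultimately have "AE x in distr \<Omega> borel Y. x \<in> (\<Inter>n. closure (?S n))"
    by (subst AE_distr_iff) measurable
  then have 1: "AE x in \<mu>. \<forall>n. x \<in> closure (?S n)" unfolding dY by simp
  have pair: "(\<integral>\<^sup>+p. real_kernel p \<partial>(distr \<Omega> borel Z \<Otimes>\<^sub>M distr \<Omega> borel Z)) = (\<integral>\<^sup>+p. real_kernel (Z (fst p), Z (snd p)) \<partial>(\<Omega> \<Otimes>\<^sub>M \<Omega>))"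
    if Z[measurable]: "Z \<in> borel_measurable \<Omega>" for Z
  proof -
    interpret D: prob_space "distr \<Omega> borel Z" by (rule \<Omega>.prob_space_distr) fact
    show ?thesis
      by (subst pair_measure_distr)
         (auto simp: nn_integral_distr case_prod_beta' D.sigma_finite_measure_axioms)
  qed
  have "(\<integral>\<^sup>+p. real_kernel p \<partial>(\<mu> \<Otimes>\<^sub>M \<mu>)) = (\<integral>\<^sup>+p. real_kernel (Y (fst p), Y (snd p)) \<partial>(\<Omega> \<Otimes>\<^sub>M \<Omega>))"
    unfolding dY[symmetric] by (rule pair) measurable
  also have "\<dots> \<le> (\<integral>\<^sup>+p. liminf (\<lambda>n. real_kernel (Yn n (fst p), Yn n (snd p))) \<partial>(\<Omega> \<Otimes>\<^sub>M \<Omega>))"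
    by (intro nn_integral_mono real_kernel_lsc lim) (auto simp: space_pair_measure)
  also have "\<dots> \<le> liminf (\<lambda>n. \<integral>\<^sup>+p. real_kernel (Yn n (fst p), Yn n (snd p)) \<partial>(\<Omega> \<Otimes>\<^sub>M \<Omega>))"
    by (rule nn_integral_liminf) measurable
  also have "\<dots> = liminf (\<lambda>n. dens_energy (h (r n)))"
    by (simp add: pair[symmetric] dYn energy_lebesgue_density h)
  also have "\<dots> \<le> liminf (\<lambda>n. e)"
    by (intro Liminf_mono always_eventually allI e)
  also have "\<dots> = e" by (simp add: Liminf_const)
  finally show thesis using that[OF \<mu> 1] by blast
qed

text \<open>Refinement returns a density below the same \<open>e\<close>, so dependent choice can
  repeat it forever. The closed supports decrease, and the one at index \<open>n\<close> was placed
  inside \<open>U n\<close>; their intersection is the compact carrier.\<close>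

lemma refine_limit:
  fixes U :: "nat \<Rightarrow> real set"
  assumes refine: "\<And>h n. lip_density h \<Longrightarrow> dens_energy h < ennreal e \<Longrightarrow> n \<ge> 1 \<Longrightarrow>
      \<exists>h'. lip_density h' \<and> dens_energy h' < ennreal e \<and> closure {x. h' x \<noteq> 0} \<subseteq> {x. h x \<noteq> 0} \<inter> U n"
    and h: "lip_density h" "dens_energy h < ennreal e"
  obtains \<mu> K where "real_distribution \<mu>" "compact K" "K \<subseteq> {0..1} \<inter> (\<Inter>n\<in>{1..}. U n)" "AE x in \<mu>. x \<in> K"
    "(\<integral>\<^sup>+p. real_kernel p \<partial>(\<mu> \<Otimes>\<^sub>M \<mu>)) \<le> ennreal e"
proof -
  have "\<exists>f. \<forall>n::nat. (lip_density (f n) \<and> dens_energy (f n) < ennreal e)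
      \<and> closure {x. f (Suc n) x \<noteq> 0} \<subseteq> {x. f n x \<noteq> 0} \<inter> U (Suc n)"
    by (rule dependent_nat_choice) (use h refine in auto)
  then obtain f where f: "\<And>n. lip_density (f n)" "\<And>n. dens_energy (f n) < ennreal e"
    "\<And>n. closure {x. f (Suc n) x \<noteq> 0} \<subseteq> {x. f n x \<noteq> 0} \<inter> U (Suc n)" by blast
  let ?K = "\<Inter>n. closure {x. f n x \<noteq> 0}"
  have "closure {x. f n x \<noteq> 0} \<subseteq> {0..1}" for n
    using f(1)[of n] by (intro closure_minimal) (auto simp: lip_density_def)
  then have K01: "?K \<subseteq> {0..1}" by blast
  have "compact ({0..1} \<inter> ?K)" by (intro compact_Int_closed closed_INT) auto
  then have c: "compact ?K" using K01 by (simp add: Int_absorb1)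
  have "?K \<subseteq> U n" if "n \<ge> 1" for n
    using f(3)[of "n - 1"] that by auto
  then have K: "?K \<subseteq> {0..1} \<inter> (\<Inter>n\<in>{1..}. U n)" using K01 by blast
  obtain \<mu> where "real_distribution \<mu>" "AE x in \<mu>. \<forall>n. x \<in> closure {x. f n x \<noteq> 0}"
    "(\<integral>\<^sup>+p. real_kernel p \<partial>(\<mu> \<Otimes>\<^sub>M \<mu>)) \<le> ennreal e"
    by (rule limit_measure[of f "ennreal e"]) (use f in \<open>auto intro: less_imp_le\<close>)
  then show thesis using that[OF _ c K] by auto
qed

section \<open>Smoothing a measure of finite energy\<close>

lemma real_kernel_antimono:
  assumes "0 < r" "r \<le> \<bar>s - t\<bar>" shows "real_kernel (s, t) \<le> ennreal (max 0 (- ln r))"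
proof -
  have "ln r \<le> ln \<bar>s - t\<bar>" using assms by (subst ln_le_cancel_iff) auto
  then show ?thesis using assms by (auto simp: real_kernel_alt intro!: ennreal_leI)
qed

text \<open>The law of \<open>(1 - d) X + d V\<close>, with \<open>X\<close> distributed by \<open>\<mu>\<close> and \<open>V\<close> by a tent on
  \<open>[0, 1]\<close>; the contraction keeps it on \<open>[0, 1]\<close>.\<close>

definition smooth_tent :: "real \<Rightarrow> real \<Rightarrow> real \<Rightarrow> real" where
  "smooth_tent d y = tent (d / 2) ((1 - d) * y + d / 2)"

text \<open>A majorant for the interaction of the tents replacing the points \<open>fst q\<close>
  and \<open>snd q\<close>. At distance \<open>D\<close> the new centres are
  \<open>(1 - d) * D\<close> apart and each tent has radius \<open>d / 2\<close>, leaving a gap of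
  at least \<open>(1 - d) * D - d\<close>; the threshold \<open>4 * d\<close> keeps it positive.
  Closer points get a multiple of the kernel itself.\<close>

definition smooth_bound :: "real \<Rightarrow> real \<times> real \<Rightarrow> ennreal" where
  "smooth_bound d q = (if 4 * d \<le> \<bar>fst q - snd q\<bar>
     then ennreal (max 0 (- ln ((1 - d) * \<bar>fst q - snd q\<bar> - d)))
     else ennreal (2 + 3 * ln 8) + 3 * real_kernel q)"

lemma contraction_gap:
  fixes d D :: real
  assumes "0 < d" "d \<le> 1/4" "4 * d \<le> D"
  shows "D / 2 \<le> (1 - d) * D - d"
proof -
  have "3/4 * D \<le> (1 - d) * D" using assms by (intro mult_right_mono) auto
  then show ?thesis using assms by linarith
qed

lemma smooth_tent_interaction:
  assumes d: "0 < d" "d \<le> 1/4" and xy: "x \<in> {0..1}" "y \<in> {0..1}"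
  shows "(\<integral>\<^sup>+p. ennreal (smooth_tent d x (fst p)) * ennreal (smooth_tent d y (snd p)) * real_kernel p \<partial>(lborel \<Otimes>\<^sub>M lborel))
    \<le> smooth_bound d (x, y)"
proof -
  let ?a = "\<lambda>x. (1 - d) * x + d / 2"
  show ?thesis
  proof (cases "4 * d \<le> \<bar>x - y\<bar>")
    case True
    let ?r = "(1 - d) * \<bar>x - y\<bar> - d"
    have "0 < 4 * d" using d by simp
    then have "0 < \<bar>x - y\<bar>" using True by (rule less_le_trans)
    then have "0 < \<bar>x - y\<bar> / 2" by simp
    then have r: "0 < ?r" using contraction_gap[OF d True] by (rule less_le_trans)
    have le: "ennreal (smooth_tent d x s) * ennreal (smooth_tent d y t) * real_kernel (s, t)
        \<le> ennreal (smooth_tent d x s) * (ennreal (smooth_tent d y t) * ennreal (max 0 (- ln ?r)))" for s t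
    proof (cases "smooth_tent d x s = 0 \<or> smooth_tent d y t = 0")
      case False
      then have "\<bar>s - ?a x\<bar> < d / 2" "\<bar>t - ?a y\<bar> < d / 2"
        using tent_eq_0[of "d / 2" s "?a x"] tent_eq_0[of "d / 2" t "?a y"] d unfolding smooth_tent_def by force+
      moreover have "\<bar>?a x - ?a y\<bar> = (1 - d) * \<bar>x - y\<bar>"
        using d by (simp add: abs_mult flip: right_diff_distrib)
      ultimately have "?r \<le> \<bar>s - t\<bar>" by linarith
      then have "real_kernel (s, t) \<le> ennreal (max 0 (- ln ?r))" using r by (intro real_kernel_antimono)
      then show ?thesis by (simp only: mult.assoc) (intro mult_left_mono; simp)
    qed auto
    have "(\<integral>\<^sup>+p. ennreal (smooth_tent d x (fst p)) * ennreal (smooth_tent d y (snd p)) * real_kernel p \<partial>(lborel \<Otimes>\<^sub>M lborel))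
      \<le> (\<integral>\<^sup>+p. ennreal (smooth_tent d x (fst p)) * (ennreal (smooth_tent d y (snd p)) * ennreal (max 0 (- ln ?r))) \<partial>(lborel \<Otimes>\<^sub>M lborel))"
      by (intro nn_integral_mono) (metis le prod.collapse)
    also have "\<dots> = (\<integral>\<^sup>+s. ennreal (smooth_tent d x s) * (\<integral>\<^sup>+t. ennreal (smooth_tent d y t) * ennreal (max 0 (- ln ?r)) \<partial>lborel) \<partial>lborel)"
      unfolding smooth_tent_def
      by (subst lborel.nn_integral_fst[symmetric], measurable, subst nn_integral_cmult[symmetric], measurable)
    also have "\<dots> = ennreal (max 0 (- ln ?r))"
      unfolding smooth_tent_def using d
      by (subst nn_integral_multc, measurable, subst nn_integral_multc, measurable, simp add: nn_integral_tent)
    finally show ?thesis using True by (simp add: smooth_bound_def)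
  next
    case False
    have "(\<integral>\<^sup>+p. ennreal (smooth_tent d x (fst p)) * ennreal (smooth_tent d y (snd p)) * real_kernel p \<partial>(lborel \<Otimes>\<^sub>M lborel))
      \<le> ennreal (2 - 3 * ln (d / 2))"
      unfolding smooth_tent_def using d by (intro tent_interaction) auto
    also have "\<dots> \<le> ennreal (2 + 3 * ln 8) + 3 * real_kernel (x, y)"
    proof (cases "x = y")
      case True
      then show ?thesis by (simp add: real_kernel_alt)
    next
      case neq: False
      \<comment> \<open>In this case \<open>d / 2\<close> exceeds an eighth of the distance, so the
        bound in terms of the radius becomes one in terms of the kernel; this is the source of
        \<open>ln 8\<close>.\<close>
      have "ln (\<bar>x - y\<bar> / 8) \<le> ln (d / 2)" using neq False d by (subst ln_le_cancel_iff) auto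
      then have 1: "2 - 3 * ln (d / 2) \<le> (2 + 3 * ln 8) + 3 * (- ln \<bar>x - y\<bar>)"
        using neq by (simp add: ln_div)
      have 0: "0 \<le> - ln \<bar>x - y\<bar>" using neq xy by auto
      have "ennreal (2 - 3 * ln (d / 2)) \<le> ennreal ((2 + 3 * ln 8) + 3 * (- ln \<bar>x - y\<bar>))"
        using 1 by (rule ennreal_leI)
      also have "\<dots> = ennreal (2 + 3 * ln 8) + ennreal 3 * ennreal (- ln \<bar>x - y\<bar>)"
        using 0 by (subst ennreal_plus, simp, simp, subst ennreal_mult) auto
      also have "\<dots> = ennreal (2 + 3 * ln 8) + 3 * real_kernel (x, y)"
        using neq 0 by (simp add: real_kernel_alt max_def)
      finally show ?thesis .
    qed
    finally show ?thesis using False by (simp add: smooth_bound_def)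
  qed
qed

text \<open>Beyond the threshold at least half of the distance survives, which costs at most
  \<open>ln 2\<close>. So one majorant independent of \<open>d\<close> covers both cases, and it is
  integrable as soon as the energy is finite.\<close>

lemma smooth_bound_dominated:
  assumes d: "0 < d" "d \<le> 1/4"
  shows "smooth_bound d q \<le> ennreal (2 + 3 * ln 8) + 3 * real_kernel q"
proof (cases "4 * d \<le> \<bar>fst q - snd q\<bar>")
  case True
  let ?D = "\<bar>fst q - snd q\<bar>"
  have r: "?D / 2 \<le> (1 - d) * ?D - d" using d True by (rule contraction_gap)
  have D: "0 < ?D" using True d by linarith
  have "ln (?D / 2) \<le> ln ((1 - d) * ?D - d)" using r D by (subst ln_le_cancel_iff) auto
  then have "max 0 (- ln ((1 - d) * ?D - d)) \<le> ln 2 + max 0 (- ln ?D)"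
    using D by (auto simp: ln_div)
  also have "\<dots> \<le> (2 + 3 * ln 8) + 3 * max 0 (- ln ?D)"
    using ln_le_cancel_iff[of 2 "8::real"] ln_gt_zero[of "8::real"] by linarith
  finally have "ennreal (max 0 (- ln ((1 - d) * ?D - d))) \<le> ennreal ((2 + 3 * ln 8) + 3 * max 0 (- ln ?D))"
    by (rule ennreal_leI)
  also have "\<dots> = ennreal (2 + 3 * ln 8) + ennreal 3 * ennreal (max 0 (- ln ?D))"
    by (subst ennreal_plus) (auto simp: ennreal_mult)
  also have "\<dots> = ennreal (2 + 3 * ln 8) + 3 * real_kernel q" using D by (auto simp: real_kernel_alt)
  finally show ?thesis using True by (simp add: smooth_bound_def)
qed (simp add: smooth_bound_def)

text \<open>Averaging tents over \<open>\<mu>\<close> keeps their common Lipschitz constant. The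
  product \<open>h s * h t\<close> is an average over pairs of points, so Tonelli turns the energy
  of \<open>h\<close> into the average pair interaction, which \<open>smooth_bound\<close>
  controls.\<close>

lemma smooth_density:
  assumes \<mu>: "real_distribution \<mu>" and supp: "AE x in \<mu>. x \<in> {0..1}"
    and d: "0 < d" "d \<le> 1/4"
  obtains h where "lip_density h" "dens_energy h \<le> (\<integral>\<^sup>+q. smooth_bound d q \<partial>(\<mu> \<Otimes>\<^sub>M \<mu>))"
proof -
  interpret real_distribution \<mu> by fact
  define h where "h x = (\<integral>y. smooth_tent d y x \<partial>\<mu>)" for x
  have [measurable (raw)]: "(\<lambda>w. smooth_tent d (u w) (v w)) \<in> borel_measurable N"
    if [measurable]: "u \<in> borel_measurable N" "v \<in> borel_measurable N" for u v :: "'b \<Rightarrow> real" and N :: "'b measure"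
    unfolding smooth_tent_def by measurable
  have nn: "0 \<le> smooth_tent d y x" for x y unfolding smooth_tent_def using d by (intro tent_nonneg) auto
  have le: "smooth_tent d y x \<le> 1 / (d / 2)" for x y unfolding smooth_tent_def using d by (intro tent_le) auto
  have int[simp]: "integrable \<mu> (\<lambda>y. smooth_tent d y x)" for x
  proof (rule integrable_const_bound[where B="1 / (d / 2)"])
    show "AE y in \<mu>. norm (smooth_tent d y x) \<le> 1 / (d / 2)" using nn le by simp
    have "(\<lambda>y. smooth_tent d y x) \<in> borel_measurable borel" unfolding smooth_tent_def by measurable
    then show "(\<lambda>y. smooth_tent d y x) \<in> borel_measurable \<mu>" by simp
  qed
  have hn: "ennreal (h x) = (\<integral>\<^sup>+y. ennreal (smooth_tent d y x) \<partial>\<mu>)" for x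
    unfolding h_def by (rule nn_integral_eq_integral[symmetric]) (auto simp: nn)
  have m1: "(\<lambda>z. ennreal (smooth_tent d (fst z) (snd z))) \<in> borel_measurable (\<mu> \<Otimes>\<^sub>M lborel)"
  proof -
    have "(\<lambda>z. ennreal (smooth_tent d (fst z) (snd z))) \<in> borel_measurable (borel \<Otimes>\<^sub>M borel)"
      unfolding smooth_tent_def by measurable
    then show ?thesis by (simp cong: measurable_cong_sets sets_pair_measure_cong)
  qed
  interpret P: pair_sigma_finite \<mu> "lborel :: real measure" ..
  interpret PP: pair_sigma_finite \<mu> \<mu> ..
  have "lip_density h"
    unfolding lip_density_def
  proof (intro conjI allI impI exI)
    fix x y
    have "\<bar>h x - h y\<bar> = \<bar>\<integral>t. smooth_tent d t x - smooth_tent d t y \<partial>\<mu>\<bar>"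
      unfolding h_def by (subst Bochner_Integration.integral_diff) auto
    also have "\<dots> \<le> (\<integral>t. \<bar>smooth_tent d t x - smooth_tent d t y\<bar> \<partial>\<mu>)"
      by (rule integral_abs_bound)
    also have "\<dots> \<le> (\<integral>t. 1 / (d / 2)\<^sup>2 * \<bar>x - y\<bar> \<partial>\<mu>)"
    proof (intro integral_mono)
      show "\<bar>smooth_tent d t x - smooth_tent d t y\<bar> \<le> 1 / (d / 2)\<^sup>2 * \<bar>x - y\<bar>" for t
        unfolding smooth_tent_def using d by (intro tent_lipschitz) auto
    qed auto
    also have "\<dots> = 1 / (d / 2)\<^sup>2 * \<bar>x - y\<bar>" using prob_space by simp
    finally show "\<bar>h x - h y\<bar> \<le> 1 / (d / 2)\<^sup>2 * \<bar>x - y\<bar>" .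
  next
    show "0 \<le> h x" for x unfolding h_def using nn by simp
  next
    fix x :: real assume x: "x \<notin> {0..1}"
    have "AE y in \<mu>. smooth_tent d y x = 0"
      using supp
    proof eventually_elim
      case (elim y)
      \<comment> \<open>The contraction leaves each centre at distance at least \<open>d / 2\<close>
        from both ends of \<open>[0,1]\<close>, exactly the radius of the tent.\<close>
      have "0 \<le> (1 - d) * y" "(1 - d) * y \<le> 1 - d"
        using elim d mult_left_mono[of y 1 "1 - d"] by auto
      moreover have "d / 2 \<le> \<bar>x - (t + d / 2)\<bar>" if "0 \<le> t" "t \<le> 1 - d" for t
        using that x d by auto
      ultimately have "d / 2 \<le> \<bar>x - ((1 - d) * y + d / 2)\<bar>" by blast
      then show ?case unfolding smooth_tent_def using d by (intro tent_eq_0) auto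
    qed
    then have "(\<integral>y. smooth_tent d y x \<partial>\<mu>) = (\<integral>y. 0 \<partial>\<mu>)"
      by (intro integral_cong_AE) (auto intro: borel_measurable_integrable)
    then show "h x = 0" by (simp add: h_def)
  next
    have "(\<integral>\<^sup>+x. ennreal (h x) \<partial>lborel) = (\<integral>\<^sup>+y. \<integral>\<^sup>+x. ennreal (smooth_tent d y x) \<partial>lborel \<partial>\<mu>)"
      unfolding hn using m1 by (intro P.Fubini') (simp add: case_prod_beta')
    also have "\<dots> = 1" unfolding smooth_tent_def using d emeasure_space_1 by (simp add: nn_integral_tent)
    finally show "(\<integral>\<^sup>+x. ennreal (h x) \<partial>lborel) = 1" .
  qed
  moreover have "dens_energy h \<le> (\<integral>\<^sup>+q. smooth_bound d q \<partial>(\<mu> \<Otimes>\<^sub>M \<mu>))"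
  proof -
    let ?T = "\<lambda>q p. ennreal (smooth_tent d (fst q) (fst p)) * ennreal (smooth_tent d (snd q) (snd p)) * real_kernel p"
    have setsPP: "sets (\<mu> \<Otimes>\<^sub>M \<mu>) = sets (borel \<Otimes>\<^sub>M borel)"
      by (intro sets_pair_measure_cong) auto
    have prod: "ennreal (h s) * ennreal (h t)
        = (\<integral>\<^sup>+q. ennreal (smooth_tent d (fst q) s) * ennreal (smooth_tent d (snd q) t) \<partial>(\<mu> \<Otimes>\<^sub>M \<mu>))" for s t
    proof -
      have [measurable]: "(\<lambda>y. ennreal (smooth_tent d y u)) \<in> borel_measurable \<mu>" for u
        using borel_measurable_integrable[OF int[of u]] by measurable
      show ?thesis
      proof -
        let ?A = "\<lambda>y. ennreal (smooth_tent d y s)" and ?B = "\<lambda>y. ennreal (smooth_tent d y t)"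
        have "(\<integral>\<^sup>+q. ?A (fst q) * ?B (snd q) \<partial>(\<mu> \<Otimes>\<^sub>M \<mu>)) = (\<integral>\<^sup>+x. \<integral>\<^sup>+y. ?A x * ?B y \<partial>\<mu> \<partial>\<mu>)"
          by (subst nn_integral_fst[symmetric]) auto
        also have "\<dots> = (\<integral>\<^sup>+x. ?A x * (\<integral>\<^sup>+y. ?B y \<partial>\<mu>) \<partial>\<mu>)"
          by (intro nn_integral_cong nn_integral_cmult) measurable
        also have "\<dots> = (\<integral>\<^sup>+x. ?A x \<partial>\<mu>) * (\<integral>\<^sup>+y. ?B y \<partial>\<mu>)"
          by (rule nn_integral_multc) measurable
        finally show ?thesis by (simp add: hn)
      qed
    qed
    have mT: "case_prod ?T \<in> borel_measurable ((\<mu> \<Otimes>\<^sub>M \<mu>) \<Otimes>\<^sub>M (lborel \<Otimes>\<^sub>M lborel))"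
    proof -
      have "case_prod ?T \<in> borel_measurable ((borel \<Otimes>\<^sub>M borel) \<Otimes>\<^sub>M (borel \<Otimes>\<^sub>M borel))"
        unfolding smooth_tent_def case_prod_beta' by measurable
      then show ?thesis
        by (subst measurable_cong_sets[OF _ refl, of _ "(borel \<Otimes>\<^sub>M borel) \<Otimes>\<^sub>M (borel \<Otimes>\<^sub>M borel)"])
           (auto intro!: sets_pair_measure_cong)
    qed
    have "dens_energy h = (\<integral>\<^sup>+p. (\<integral>\<^sup>+q. ?T q p \<partial>(\<mu> \<Otimes>\<^sub>M \<mu>)) \<partial>(lborel \<Otimes>\<^sub>M lborel))"
      unfolding dens_energy_def prod
    proof (intro nn_integral_cong nn_integral_multc[symmetric])
      fix p
      have "(\<lambda>q. ennreal (smooth_tent d (fst q) (fst p)) * ennreal (smooth_tent d (snd q) (snd p))) \<in> borel_measurable (borel \<Otimes>\<^sub>M borel)"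
        unfolding smooth_tent_def by measurable
      then show "(\<lambda>q. ennreal (smooth_tent d (fst q) (fst p)) * ennreal (smooth_tent d (snd q) (snd p))) \<in> borel_measurable (\<mu> \<Otimes>\<^sub>M \<mu>)"
        by (simp add: measurable_cong_sets[OF setsPP refl])
    qed
    also have "\<dots> = (\<integral>\<^sup>+q. (\<integral>\<^sup>+p. ?T q p \<partial>(lborel \<Otimes>\<^sub>M lborel)) \<partial>(\<mu> \<Otimes>\<^sub>M \<mu>))"
      by (rule nn_integral_swap_pair[symmetric, OF _ mT]) (rule PP.P.sigma_finite_measure_axioms)
    also have "\<dots> \<le> (\<integral>\<^sup>+q. smooth_bound d q \<partial>(\<mu> \<Otimes>\<^sub>M \<mu>))"
    proof (rule nn_integral_mono_AE)
      have "AE x in \<mu>. AE y in \<mu>. fst (x, y) \<in> {0..1} \<and> snd (x, y) \<in> {0..1}"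
        using supp
      proof eventually_elim
        case (elim x)
        show ?case using supp by eventually_elim (use elim in simp)
      qed
      then have "AE q in \<mu> \<Otimes>\<^sub>M \<mu>. fst q \<in> {0..1} \<and> snd q \<in> {0..1}"
        by (rule PP.AE_pair_measure[rotated]) measurable
      then show "AE q in \<mu> \<Otimes>\<^sub>M \<mu>. (\<integral>\<^sup>+p. ?T q p \<partial>(lborel \<Otimes>\<^sub>M lborel)) \<le> smooth_bound d q"
      proof eventually_elim
        case (elim q)
        then show ?case using smooth_tent_interaction[OF d, of "fst q" "snd q"] by simp
      qed
    qed
    finally show ?thesis .
  qed
  ultimately show thesis using that by blast
qed

text \<open>Finite energy makes the diagonal null for the product measure, and off the diagonal
  \<open>smooth_bound\<close> converges to the kernel as \<open>d\<close> tends to 0. Dominated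
  convergence then carries the strict inequality over to a small positive \<open>d\<close>.\<close>

lemma approx_by_density:
  assumes \<mu>: "real_distribution \<mu>" and supp: "AE x in \<mu>. x \<in> {0..1}"
    and e: "(\<integral>\<^sup>+p. real_kernel p \<partial>(\<mu> \<Otimes>\<^sub>M \<mu>)) < ennreal e"
  obtains h where "lip_density h" "dens_energy h < ennreal e"
proof -
  interpret real_distribution \<mu> by fact
  interpret PP: pair_prob_space \<mu> \<mu> ..
  let ?d = "\<lambda>n::nat. 1 / (real n + 4)"
  have d: "0 < ?d n" "?d n \<le> 1/4" for n by (auto simp: field_simps)
  have setsPP: "sets (\<mu> \<Otimes>\<^sub>M \<mu>) = sets (borel \<Otimes>\<^sub>M borel)"
    by (intro sets_pair_measure_cong) auto
  have km[measurable]: "real_kernel \<in> borel_measurable (\<mu> \<Otimes>\<^sub>M \<mu>)"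
    using real_kernel_measurable by (simp add: measurable_cong_sets[OF setsPP refl])
  have sm: "smooth_bound \<delta> \<in> borel_measurable (\<mu> \<Otimes>\<^sub>M \<mu>)" for \<delta>
  proof -
    have "smooth_bound \<delta> = (\<lambda>q. if 4 * \<delta> \<le> \<bar>fst q - snd q\<bar>
     then ennreal (max 0 (- ln ((1 - \<delta>) * \<bar>fst q - snd q\<bar> - \<delta>)))
     else ennreal (2 + 3 * ln 8) + 3 * real_kernel q)" by (rule ext) (rule smooth_bound_def)
    then have "smooth_bound \<delta> \<in> borel_measurable (borel \<Otimes>\<^sub>M borel)" by (elim ssubst) measurable
    then show ?thesis by (simp add: measurable_cong_sets[OF setsPP refl])
  qed
  have fin: "(\<integral>\<^sup>+p. real_kernel p \<partial>(\<mu> \<Otimes>\<^sub>M \<mu>)) < top" using e by (rule less_trans) simp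
  have "(\<lambda>n. \<integral>\<^sup>+q. smooth_bound (?d n) q \<partial>(\<mu> \<Otimes>\<^sub>M \<mu>)) \<longlonglongrightarrow> (\<integral>\<^sup>+q. real_kernel q \<partial>(\<mu> \<Otimes>\<^sub>M \<mu>))"
  proof (rule nn_integral_dominated_convergence[where w="\<lambda>q. ennreal (2 + 3 * ln 8) + 3 * real_kernel q"])
    show "AE q in \<mu> \<Otimes>\<^sub>M \<mu>. smooth_bound (?d n) q \<le> ennreal (2 + 3 * ln 8) + 3 * real_kernel q" for n
      using d by (intro AE_I2 smooth_bound_dominated)
    have "(\<integral>\<^sup>+q. ennreal (2 + 3 * ln 8) + 3 * real_kernel q \<partial>(\<mu> \<Otimes>\<^sub>M \<mu>))
        = ennreal (2 + 3 * ln 8) + 3 * (\<integral>\<^sup>+q. real_kernel q \<partial>(\<mu> \<Otimes>\<^sub>M \<mu>))"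
      by (subst nn_integral_add) (auto simp: nn_integral_cmult PP.emeasure_space_1)
    also have "\<dots> < \<infinity>" using fin by (simp add: ennreal_mult_less_top)
    finally show "(\<integral>\<^sup>+q. ennreal (2 + 3 * ln 8) + 3 * real_kernel q \<partial>(\<mu> \<Otimes>\<^sub>M \<mu>)) < \<infinity>" .
    have "AE q in \<mu> \<Otimes>\<^sub>M \<mu>. real_kernel q \<noteq> \<infinity>"
      using fin by (intro nn_integral_PInf_AE) auto
    then show "AE q in \<mu> \<Otimes>\<^sub>M \<mu>. (\<lambda>n. smooth_bound (?d n) q) \<longlonglongrightarrow> real_kernel q"
    proof eventually_elim
      case (elim q)
      let ?D = "\<bar>fst q - snd q\<bar>"
      have D: "0 < ?D" using elim by (auto simp: real_kernel_alt split: if_splits)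
      have d0: "?d \<longlonglongrightarrow> 0" by real_asymp
      have "(\<lambda>n. ennreal (max 0 (- ln ((1 - ?d n) * ?D - ?d n)))) \<longlonglongrightarrow> ennreal (max 0 (- ln ((1 - 0) * ?D - 0)))"
        using D by (intro tendsto_ennrealI tendsto_max tendsto_minus tendsto_ln tendsto_intros d0) auto
      also have "ennreal (max 0 (- ln ((1 - 0) * ?D - 0))) = real_kernel q" using D by (auto simp: real_kernel_alt)
      finally have lim: "(\<lambda>n. ennreal (max 0 (- ln ((1 - ?d n) * ?D - ?d n)))) \<longlonglongrightarrow> real_kernel q" .
      have "(\<lambda>n. 4 * ?d n) \<longlonglongrightarrow> 4 * 0" by (intro tendsto_intros d0)
      then have "\<forall>\<^sub>F n in sequentially. 4 * ?d n < ?D" using D by (intro order_tendstoD) auto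
      then have "\<forall>\<^sub>F n in sequentially. ennreal (max 0 (- ln ((1 - ?d n) * ?D - ?d n))) = smooth_bound (?d n) q"
        by eventually_elim (simp add: smooth_bound_def)
      with lim show ?case by (rule Lim_transform_eventually)
    qed
  qed (use sm in auto)
  then have "\<forall>\<^sub>F n in sequentially. (\<integral>\<^sup>+q. smooth_bound (?d n) q \<partial>(\<mu> \<Otimes>\<^sub>M \<mu>)) < ennreal e"
    using e by (rule order_tendstoD)
  then obtain n where n: "(\<integral>\<^sup>+q. smooth_bound (?d n) q \<partial>(\<mu> \<Otimes>\<^sub>M \<mu>)) < ennreal e"
    using eventually_happens'[OF sequentially_bot] by blast
  obtain h where h: "lip_density h" "dens_energy h \<le> (\<integral>\<^sup>+q. smooth_bound (?d n) q \<partial>(\<mu> \<Otimes>\<^sub>M \<mu>))"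
    using smooth_density[OF \<mu> supp d] by blast
  show thesis by (rule that[OF h(1) le_less_trans[OF h(2) n]])
qed

section \<open>Capacity\<close>

lemma log_kernel_pos_measurable [measurable]:
  "(\<lambda>p. log_kernel_pos (fst p) (snd p)) \<in> borel_measurable (borel \<Otimes>\<^sub>M borel)"
  unfolding log_kernel_pos_def by measurable

text \<open>The complement of the support is a union of null balls; by Lindelof countably many of
  them suffice, so it is null.\<close>

lemma AE_msupport:
  assumes s: "sets \<nu> = sets borel"
  shows "AE z in \<nu>. z \<in> msupport \<nu>"
proof -
  let ?F = "{ball z e |z e. emeasure \<nu> (ball z e) = 0}"
  have F: "open B" "emeasure \<nu> B = 0" if "B \<in> ?F" for B using that by auto
  obtain F' where F': "F' \<subseteq> ?F" "countable F'" "\<Union>F' = \<Union>?F"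
    by (rule Lindelof[of ?F, OF F(1)])
  have null: "(\<Union>B\<in>F'. B) \<in> null_sets \<nu>"
  proof (rule null_sets_UN')
    fix B assume "B \<in> F'"
    then have "B \<in> ?F" by (rule subsetD[OF F'(1)])
    note B = F[OF this]
    have "B \<in> sets \<nu>" unfolding s using B(1) by (rule borel_open)
    with B(2) show "B \<in> null_sets \<nu>" by (rule null_setsI)
  qed (rule F'(2))
  have sp: "space \<nu> = UNIV" using sets_eq_imp_space_eq[OF s] by simp
  show ?thesis
  proof (rule AE_I'[OF null])
    show "{z \<in> space \<nu>. z \<notin> msupport \<nu>} \<subseteq> (\<Union>B\<in>F'. B)"
    proof
      fix z assume "z \<in> {z \<in> space \<nu>. z \<notin> msupport \<nu>}"
      then obtain e where "e > 0" "emeasure \<nu> (ball z e) = 0" by (auto simp: msupport_def not_gr_zero)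
      then have "z \<in> \<Union>?F" by (intro UnionI[of "ball z e"]) auto
      then show "z \<in> (\<Union>B\<in>F'. B)" unfolding F'(3)[symmetric] by simp
    qed
  qed
qed

lemma msupport_subset_closed:
  assumes s: "sets \<nu> = sets borel" and K: "closed K" "AE z in \<nu>. z \<in> K"
  shows "msupport \<nu> \<subseteq> K"
proof
  fix z assume z: "z \<in> msupport \<nu>"
  show "z \<in> K"
  proof (rule ccontr)
    assume "z \<notin> K"
    then obtain e where e: "e > 0" "ball z e \<subseteq> - K"
      using K(1) by (metis ComplI closed_def openE)
    have "AE x in \<nu>. x \<notin> ball z e" using K(2) by eventually_elim (use e in auto)
    then have "emeasure \<nu> (ball z e) = 0"
      using s by (subst (asm) AE_iff_measurable[of "ball z e"]) (auto simp: sets_eq_imp_space_eq[OF s])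
    then show False using z e by (force simp: msupport_def)
  qed
qed

lemma closed_msupport:
  "closed (msupport \<nu>)" if s: "sets \<nu> = sets borel"
proof -
  have "\<exists>e>0. ball z e \<subseteq> - msupport \<nu>" if z: "z \<in> - msupport \<nu>" for z
  proof -
    obtain e where e: "e > 0" "emeasure \<nu> (ball z e) = 0" using z by (auto simp: msupport_def not_gr_zero)
    have "y \<notin> msupport \<nu>" if y: "y \<in> ball z e" for y
    proof -
      obtain r where r: "r > 0" "ball y r \<subseteq> ball z e" by (rule openE[OF open_ball y])
      have "emeasure \<nu> (ball y r) \<le> emeasure \<nu> (ball z e)" using r s by (intro emeasure_mono) auto
      then show ?thesis using e r by (auto simp: msupport_def not_gr_zero intro!: exI[of _ r])
    qed
    then show ?thesis using e by blast
  qed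
  then show ?thesis by (auto simp: closed_def open_contains_ball)
qed

text \<open>Distances in the unit interval do not exceed 1, so the subtracted integral is zero; the
  remaining one depends only on real parts and passes to the image under \<open>Re\<close>.\<close>

lemma log_energy_unit_interval:
  assumes \<nu>: "sets \<nu> = sets borel" "prob_space \<nu>" and supp: "AE z in \<nu>. z \<in> complex_of_real ` {0..1}"
  shows "log_energy \<nu> = enn2ereal (\<integral>\<^sup>+p. real_kernel p \<partial>(distr \<nu> borel Re \<Otimes>\<^sub>M distr \<nu> borel Re))"
proof -
  interpret prob_space \<nu> by fact
  interpret PP: pair_prob_space \<nu> \<nu> ..
  have meas: "measurable \<nu> N = measurable borel N" for N :: "'z measure" by (rule measurable_cong_sets[OF \<nu>(1) refl])
  have [measurable]: "Re \<in> borel_measurable \<nu>" unfolding meas by measurable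
  have "closed (complex_of_real ` {0..1})"
    by (intro compact_imp_closed compact_continuous_image continuous_intros) auto
  then have [measurable]: "complex_of_real ` {0..1} \<in> sets \<nu>" using \<nu> by auto
  have "AE x in \<nu>. AE y in \<nu>. fst (x, y) \<in> complex_of_real ` {0..1} \<and> snd (x, y) \<in> complex_of_real ` {0..1}"
    using supp
  proof eventually_elim
    case (elim x)
    show ?case using supp by eventually_elim (use elim in simp)
  qed
  then have AE: "AE p in \<nu> \<Otimes>\<^sub>M \<nu>. fst p \<in> complex_of_real ` {0..1} \<and> snd p \<in> complex_of_real ` {0..1}"
    by (rule PP.AE_pair_measure[rotated]) measurable
  have "(\<integral>\<^sup>+p. log_kernel_neg (fst p) (snd p) \<partial>(\<nu> \<Otimes>\<^sub>M \<nu>)) = (\<integral>\<^sup>+p. 0 \<partial>(\<nu> \<Otimes>\<^sub>M \<nu>))"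
  proof (rule nn_integral_cong_AE)
    show "AE p in \<nu> \<Otimes>\<^sub>M \<nu>. log_kernel_neg (fst p) (snd p) = 0"
      using AE
    proof eventually_elim
      case (elim p)
      then obtain x y where xy: "fst p = complex_of_real x" "snd p = complex_of_real y" "x \<in> {0..1}" "y \<in> {0..1}" by auto
      have "\<bar>x - y\<bar> \<le> 1" using xy by auto
      then have "x \<noteq> y \<Longrightarrow> ln \<bar>x - y\<bar> \<le> 0" by simp
      then show ?case using xy by (auto simp: log_kernel_neg_def simp flip: of_real_diff)
    qed
  qed
  then have neg: "(\<integral>\<^sup>+p. log_kernel_neg (fst p) (snd p) \<partial>(\<nu> \<Otimes>\<^sub>M \<nu>)) = 0" by simp
  interpret D: prob_space "distr \<nu> borel Re" by (rule prob_space_distr) measurable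
  have "(\<integral>\<^sup>+p. real_kernel p \<partial>(distr \<nu> borel Re \<Otimes>\<^sub>M distr \<nu> borel Re))
      = (\<integral>\<^sup>+p. real_kernel (Re (fst p), Re (snd p)) \<partial>(\<nu> \<Otimes>\<^sub>M \<nu>))"
    by (subst pair_measure_distr) (auto simp: nn_integral_distr case_prod_beta' D.sigma_finite_measure_axioms)
  also have "\<dots> = (\<integral>\<^sup>+p. log_kernel_pos (fst p) (snd p) \<partial>(\<nu> \<Otimes>\<^sub>M \<nu>))"
  proof (rule nn_integral_cong_AE)
    show "AE p in \<nu> \<Otimes>\<^sub>M \<nu>. real_kernel (Re (fst p), Re (snd p)) = log_kernel_pos (fst p) (snd p)"
      using AE by eventually_elim (auto simp: real_kernel_def)
  qed
  finally show ?thesis unfolding log_energy_def log_interaction_def neg by (simp add: zero_ennreal.rep_eq)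
qed

lemma cap_measure_to_real:
  assumes "\<nu> \<in> cap_measures (complex_of_real ` {0..1})"
  obtains \<mu> where "real_distribution \<mu>" "AE x in \<mu>. x \<in> {0..1}"
    "log_energy \<nu> = enn2ereal (\<integral>\<^sup>+p. real_kernel p \<partial>(\<mu> \<Otimes>\<^sub>M \<mu>))"
proof -
  have \<nu>: "sets \<nu> = sets borel" "prob_space \<nu>" "msupport \<nu> \<subseteq> complex_of_real ` {0..1}"
    using assms by (auto simp: cap_measures_def)
  have supp: "AE z in \<nu>. z \<in> complex_of_real ` {0..1}"
    using AE_msupport[OF \<nu>(1)] by eventually_elim (use \<nu>(3) in auto)
  have Re: "Re \<in> borel_measurable \<nu>"
    unfolding measurable_cong_sets[OF \<nu>(1) refl] by measurable
  show thesis
  proof (rule that)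
    interpret prob_space \<nu> by fact
    interpret D: prob_space "distr \<nu> borel Re" by (rule prob_space_distr[OF Re])
    show "real_distribution (distr \<nu> borel Re)" using Re by (rule real_distribution_distr)
    show "AE x in distr \<nu> borel Re. x \<in> {0..1}"
      using supp by (subst AE_distr_iff[OF Re]) (auto elim!: eventually_mono)
    show "log_energy \<nu> = enn2ereal (\<integral>\<^sup>+p. real_kernel p \<partial>(distr \<nu> borel Re \<Otimes>\<^sub>M distr \<nu> borel Re))"
      by (rule log_energy_unit_interval[OF \<nu>(1,2) supp])
  qed
qed

lemma real_to_cap_measure:
  assumes \<mu>: "real_distribution \<mu>" and K: "compact K" "K \<subseteq> {0..1}" "AE x in \<mu>. x \<in> K"
    and S: "complex_of_real ` K \<subseteq> S"
  obtains \<nu> where "\<nu> \<in> cap_measures S" "log_energy \<nu> = enn2ereal (\<integral>\<^sup>+p. real_kernel p \<partial>(\<mu> \<Otimes>\<^sub>M \<mu>))"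
proof -
  interpret real_distribution \<mu> by fact
  define \<nu> where "\<nu> = distr \<mu> borel complex_of_real"
  have [measurable]: "complex_of_real \<in> borel_measurable \<mu>"
    by (simp add: measurable_cong_sets[OF events_eq_borel refl])
  have s: "sets \<nu> = sets borel" by (simp add: \<nu>_def)
  have p: "prob_space \<nu>" unfolding \<nu>_def by (rule prob_space_distr) measurable
  have cK: "compact (complex_of_real ` K)"
    using K by (intro compact_continuous_image continuous_intros)
  have [measurable]: "complex_of_real ` K \<in> sets borel" using cK by (intro borel_closed compact_imp_closed)
  have AEK: "AE z in \<nu>. z \<in> complex_of_real ` K"
    unfolding \<nu>_def by (subst AE_distr_iff) (use K(3) in \<open>auto elim!: eventually_mono\<close>)
  have sub: "msupport \<nu> \<subseteq> complex_of_real ` K"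
    using cK AEK by (intro msupport_subset_closed s compact_imp_closed)
  have "compact (complex_of_real ` K \<inter> msupport \<nu>)"
    using cK closed_msupport[OF s] by (rule compact_Int_closed)
  then have "compact (msupport \<nu>)" using sub by (simp add: Int_absorb1)
  then have "\<nu> \<in> cap_measures S" using s p sub S by (auto simp: cap_measures_def)
  moreover have "log_energy \<nu> = enn2ereal (\<integral>\<^sup>+p. real_kernel p \<partial>(\<mu> \<Otimes>\<^sub>M \<mu>))"
  proof -
    have "distr \<nu> borel Re = distr \<mu> borel (\<lambda>x. x)"
      unfolding \<nu>_def by (subst distr_distr) (auto simp: o_def)
    also have "\<dots> = \<mu>" by (rule distr_id2) simp
    finally have "distr \<nu> borel Re = \<mu>" .
    moreover have "AE z in \<nu>. z \<in> complex_of_real ` {0..1}"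
      using AEK by eventually_elim (use K(2) in auto)
    ultimately show ?thesis using log_energy_unit_interval[OF s p] by simp
  qed
  ultimately show thesis using that by blast
qed

lemma log_energy_nonneg:
  assumes "\<nu> \<in> cap_measures (complex_of_real ` {0..1})" shows "0 \<le> log_energy \<nu>"
  using cap_measure_to_real[OF assms] by (metis enn2ereal_nonneg)

text \<open>The capacity is zero only if the infimum is infinite, so one measure of finite energy
  suffices for positivity. The tent filling \<open>[0,1]\<close> is such a measure.\<close>

lemma finite_energy_unit_interval: "(INF \<nu>\<in>cap_measures (complex_of_real ` {0..1}). log_energy \<nu>) < \<infinity>"
proof -
  let ?h = "tent (1/2) (1/2)"
  have h: "lip_density ?h"
    unfolding lip_density_def
  proof (intro conjI allI impI exI)
    show "\<bar>?h x - ?h y\<bar> \<le> 1 / (1/2)\<^sup>2 * \<bar>x - y\<bar>" for x y by (rule tent_lipschitz) simp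
    show "0 \<le> ?h x" for x by (rule tent_nonneg) simp
    show "?h x = 0" if "x \<notin> {0..1}" for x using that by (intro tent_eq_0) auto
    show "(\<integral>\<^sup>+x. ennreal (?h x) \<partial>lborel) = 1" by (rule nn_integral_tent) simp
  qed
  have "AE x in lebesgue_density ?h. x \<in> {0..1}"
    using AE_lebesgue_density[OF h] by eventually_elim (use h in \<open>auto simp: lip_density_def\<close>)
  then obtain \<nu> where \<nu>: "\<nu> \<in> cap_measures (complex_of_real ` {0..1})"
      "log_energy \<nu> = enn2ereal (\<integral>\<^sup>+p. real_kernel p \<partial>(lebesgue_density ?h \<Otimes>\<^sub>M lebesgue_density ?h))"
    using real_to_cap_measure[OF real_distribution_lebesgue_density[OF h], of "{0..1}" "complex_of_real ` {0..1}"] by auto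
  have "dens_energy ?h \<le> ennreal (2 - 3 * ln (1/2))"
    unfolding dens_energy_def by (rule tent_interaction) auto
  then have "log_energy \<nu> \<le> enn2ereal (ennreal (2 - 3 * ln (1/2)))"
    unfolding \<nu>(2) energy_lebesgue_density[OF h] by (simp add: less_eq_ennreal.rep_eq)
  also have "\<dots> < \<infinity>" by (simp add: enn2ereal_ennreal ln_div)
  finally show ?thesis by (rule le_less_trans[OF INF_lower[OF \<nu>(1)]])
qed

text \<open>The deterministic core: all randomness is confined to the hypothesis
  \<open>refine\<close>. Monotonicity gives one inequality of infima; for the other, a competitor on
  the interval is smoothed, refined and passed to the limit at the cost of an arbitrary
  \<open>\<epsilon>\<close> in energy.\<close>

lemma log_capacity_eq:
  assumes sub: "S \<subseteq> complex_of_real ` {0..1}"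
    and S: "complex_of_real ` ({0..1} \<inter> (\<Inter>n\<in>{1..}. U n)) \<subseteq> S"
    and refine: "\<And>h e n. lip_density h \<Longrightarrow> dens_energy h < ennreal e \<Longrightarrow> n \<ge> (1::nat) \<Longrightarrow>
      \<exists>h'. lip_density h' \<and> dens_energy h' < ennreal e \<and> closure {x. h' x \<noteq> 0} \<subseteq> {x. h x \<noteq> 0} \<inter> U n"
  shows "log_capacity S = log_capacity (complex_of_real ` {0..1})"
proof -
  have "cap_measures S \<subseteq> cap_measures (complex_of_real ` {0..1})"
    using sub by (auto simp: cap_measures_def)
  then have 1: "(INF \<nu>\<in>cap_measures (complex_of_real ` {0..1}). log_energy \<nu>) \<le> (INF \<nu>\<in>cap_measures S. log_energy \<nu>)"
    by (rule INF_superset_mono) simp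
  have "(INF \<nu>\<in>cap_measures S. log_energy \<nu>) \<le> log_energy \<nu>"
    if \<nu>: "\<nu> \<in> cap_measures (complex_of_real ` {0..1})" for \<nu>
  proof (rule ereal_le_real)
    \<comment> \<open>Testing against real upper bounds \<open>t\<close> disposes of infinite
      energy, where no such \<open>t\<close> exists.\<close>
    fix t assume "log_energy \<nu> \<le> ereal t"
    obtain \<mu> where \<mu>: "real_distribution \<mu>" "AE x in \<mu>. x \<in> {0..1}"
      "log_energy \<nu> = enn2ereal (\<integral>\<^sup>+p. real_kernel p \<partial>(\<mu> \<Otimes>\<^sub>M \<mu>))" using cap_measure_to_real[OF \<nu>] by blast
    have t0: "0 \<le> t" using \<open>log_energy \<nu> \<le> ereal t\<close> log_energy_nonneg[OF \<nu>] by (metis ereal_less_eq(5) order_trans)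
    show "(INF \<nu>\<in>cap_measures S. log_energy \<nu>) \<le> ereal t"
    proof (rule ereal_le_epsilon2)
      fix \<epsilon> :: real assume "\<epsilon> > 0"
      have "(\<integral>\<^sup>+p. real_kernel p \<partial>(\<mu> \<Otimes>\<^sub>M \<mu>)) \<le> ennreal t"
        using \<open>log_energy \<nu> \<le> ereal t\<close> t0 unfolding \<mu>(3) by (simp add: less_eq_ennreal.rep_eq enn2ereal_ennreal)
      also have "\<dots> < ennreal (t + \<epsilon>)" using t0 \<open>\<epsilon> > 0\<close> by (intro ennreal_lessI) auto
      finally obtain h where h: "lip_density h" "dens_energy h < ennreal (t + \<epsilon>)"
        using approx_by_density[OF \<mu>(1,2)] by blast
      obtain \<mu>' K where \<mu>': "real_distribution \<mu>'" "compact K" "K \<subseteq> {0..1} \<inter> (\<Inter>n\<in>{1..}. U n)" "AE x in \<mu>'. x \<in> K"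
        "(\<integral>\<^sup>+p. real_kernel p \<partial>(\<mu>' \<Otimes>\<^sub>M \<mu>')) \<le> ennreal (t + \<epsilon>)"
      proof (rule refine_limit[of "t + \<epsilon>" U h])
        fix h and n :: nat assume "lip_density h" "dens_energy h < ennreal (t + \<epsilon>)" "n \<ge> 1"
        then show "\<exists>h'. lip_density h' \<and> dens_energy h' < ennreal (t + \<epsilon>) \<and> closure {x. h' x \<noteq> 0} \<subseteq> {x. h x \<noteq> 0} \<inter> U n"
          by (rule refine)
      qed (rule h | rule that; assumption)+
      obtain \<nu>' where \<nu>': "\<nu>' \<in> cap_measures S" "log_energy \<nu>' = enn2ereal (\<integral>\<^sup>+p. real_kernel p \<partial>(\<mu>' \<Otimes>\<^sub>M \<mu>'))"
        by (rule real_to_cap_measure[OF \<mu>'(1,2) _ \<mu>'(4) order_trans[OF image_mono[OF \<mu>'(3)] S]])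
           (use \<mu>'(3) in blast)
      have "log_energy \<nu>' \<le> enn2ereal (ennreal (t + \<epsilon>))"
        using \<mu>'(5) unfolding \<nu>'(2) by (simp add: less_eq_ennreal.rep_eq)
      also have "\<dots> = ereal t + ereal \<epsilon>" using t0 \<open>\<epsilon> > 0\<close> by (subst enn2ereal_ennreal) auto
      finally show "(INF \<nu>\<in>cap_measures S. log_energy \<nu>) \<le> ereal t + ereal \<epsilon>"
        using \<nu>'(1) by (rule INF_lower2[rotated])
    qed
  qed
  then have "(INF \<nu>\<in>cap_measures S. log_energy \<nu>) \<le> (INF \<nu>\<in>cap_measures (complex_of_real ` {0..1}). log_energy \<nu>)"
    by (rule INF_greatest)
  with 1 have "(INF \<nu>\<in>cap_measures S. log_energy \<nu>) = (INF \<nu>\<in>cap_measures (complex_of_real ` {0..1}). log_energy \<nu>)"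
    by (rule antisym[rotated])
  then show ?thesis by (simp add: log_capacity_def)
qed

section \<open>The limsup set of the random intervals\<close>

lemma log_capacity_unit_interval_pos: "log_capacity (complex_of_real ` {0..1}) > 0"
  using finite_energy_unit_interval by (auto simp: log_capacity_def Let_def)

text \<open>An interval with centre in \<open>[0,1]\<close> protrudes by less than half its length.
  These lengths tend to 0, so a point covered infinitely often cannot lie outside.\<close>

lemma limsup_intervals_subset:
  fixes v :: "nat \<Rightarrow> real"
  assumes lam: "lam > 0" and v: "\<And>k. k \<ge> 1 \<Longrightarrow> v k \<in> {0..1}"
  shows "(\<Inter>m\<in>{1..}. \<Union>k\<in>{m..}.
      complex_of_real ` {v k - exp (- lam * real k) / 2 <..< v k + exp (- lam * real k) / 2})
    \<subseteq> complex_of_real ` {0..1}"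
proof
  fix z assume z: "z \<in> (\<Inter>m\<in>{1..}. \<Union>k\<in>{m..}.
      complex_of_real ` {v k - exp (- lam * real k) / 2 <..< v k + exp (- lam * real k) / 2})"
  then obtain x where x: "z = complex_of_real x" by force
  have bd: "- (exp (- lam * real m) / 2) \<le> x \<and> x \<le> 1 + exp (- lam * real m) / 2" if m: "m \<ge> 1" for m
  proof -
    obtain k where k: "k \<ge> m" "x \<in> {v k - exp (- lam * real k) / 2 <..< v k + exp (- lam * real k) / 2}"
      using z m unfolding x by fastforce
    have "exp (- lam * real k) \<le> exp (- lam * real m)" using k lam by simp
    moreover have "0 \<le> v k" "v k \<le> 1" using v[of k] k m by auto
    moreover note k(2)[unfolded greaterThanLessThan_iff]
    ultimately show ?thesis by linarith
  qed
  have l: "(\<lambda>m. exp (- lam * real m) / 2) \<longlonglongrightarrow> 0" using lam by real_asymp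
  have "- 0 \<le> x"
    by (rule LIMSEQ_le_const2[OF tendsto_minus[OF l]]) (use bd in blast)
  moreover have "x \<le> 1 + 0"
    by (rule LIMSEQ_le_const[OF tendsto_add[OF tendsto_const l]]) (use bd in blast)
  ultimately show "z \<in> complex_of_real ` {0..1}" using x by auto
qed

theorem theorem1p2:
  fixes M :: "'a measure" and c :: "nat \<Rightarrow> 'a \<Rightarrow> real"
    and f :: "real \<Rightarrow> ennreal" and lam B :: real
  assumes "prob_space M"
    and "lam > 0"
    and "prob_space.indep_vars M (\<lambda>_. borel) c {1..}"
    and "\<And>k. k \<ge> 1 \<Longrightarrow> distributed M lborel (c k) f"
    and "\<And>x. x \<notin> {0..1} \<Longrightarrow> f x = 0"
    and "\<And>x. f x \<le> ennreal B"
    and "AE x in lborel. x \<in> {0..1} \<longrightarrow> f x > 0"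
  shows "AE \<omega> in M.
           log_capacity
             (\<Inter>m\<in>{1..}. \<Union>k\<in>{m..}.
                complex_of_real ` {c k \<omega> - exp (- lam * real k) / 2 <..< c k \<omega> + exp (- lam * real k) / 2})
           = log_capacity (complex_of_real ` {0..1})
         \<and> log_capacity (complex_of_real ` {0..1}) > 0"
proof -
  interpret random_points M c f lam B
    unfolding random_points_def random_points_axioms_def using assms(1-4,6,7) by blast
  \<comment> \<open>The density vanishes off \<open>[0,1]\<close>, so almost surely all centres lie
    there; this serves the inclusion of the limsup set in the unit interval.\<close>
  have "AE \<omega> in M. \<forall>k. k \<ge> 1 \<longrightarrow> c k \<omega> \<in> {0..1}"
    unfolding AE_all_countable
  proof
    fix k
    show "AE \<omega> in M. k \<ge> 1 \<longrightarrow> c k \<omega> \<in> {0..1}"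
    proof (cases "k \<ge> 1")
      case True
      note [measurable] = c_measurable[OF True]
      have "(\<integral>\<^sup>+\<omega>. indicator (- {0..1}) (c k \<omega>) \<partial>M) = (\<integral>\<^sup>+x. f x * indicator (- {0..1}) x \<partial>lborel)"
        by (rule distributed_nn_integral[OF distr[OF True], symmetric]) simp
      also have "\<dots> = (\<integral>\<^sup>+x. 0 \<partial>(lborel :: real measure))"
        using assms(5) by (intro nn_integral_cong) (auto simp: indicator_def)
      finally have "(\<integral>\<^sup>+\<omega>. indicator (- {0..1}) (c k \<omega>) \<partial>M) = 0" by simp
      then have "AE \<omega> in M. indicator (- {0..1}) (c k \<omega>) = (0::ennreal)"
        by (subst (asm) nn_integral_0_iff_AE) auto
      then show ?thesis by eventually_elim (auto simp: indicator_def split: if_splits)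
    qed simp
  qed
  with AE_refine_all show ?thesis
  proof eventually_elim
    case (elim \<omega>)
    let ?U = "\<lambda>n. \<Union>k\<in>{n..}. {c k \<omega> - 2 * rad k <..< c k \<omega> + 2 * rad k}"
    \<comment> \<open>Twice the tent radius is the half-length of the interval, which identifies the
      sets of the refinement with the given random intervals.\<close>
    have rad2: "2 * rad k = exp (- lam * real k) / 2" for k by (simp add: rad_def)
    show ?case
    proof (intro conjI log_capacity_unit_interval_pos log_capacity_eq[where U="?U"])
      show "complex_of_real ` ({0..1} \<inter> (\<Inter>n\<in>{1..}. ?U n)) \<subseteq> (\<Inter>m\<in>{1..}. \<Union>k\<in>{m..}.
          complex_of_real ` {c k \<omega> - exp (- lam * real k) / 2 <..< c k \<omega> + exp (- lam * real k) / 2})"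
        unfolding rad2 by fastforce
      show "(\<Inter>m\<in>{1..}. \<Union>k\<in>{m..}.
          complex_of_real ` {c k \<omega> - exp (- lam * real k) / 2 <..< c k \<omega> + exp (- lam * real k) / 2})
        \<subseteq> complex_of_real ` {0..1}"
        using elim(2) by (intro limsup_intervals_subset lam_pos) blast
      show "\<exists>h'. lip_density h' \<and> dens_energy h' < ennreal e \<and> closure {x. h' x \<noteq> 0} \<subseteq> {x. h x \<noteq> 0} \<inter> ?U n"
        if "lip_density h" "dens_energy h < ennreal e" "n \<ge> 1" for h e n
        using elim(1)[rule_format, OF that] .
    qed
  qed
qed

end
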